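(* $\frac12\mathsf C_{[0,1]}\equiv_{\mathrm W}(\mathsf C_{\{0,1\}}\rightarrow\mathsf C_{[0,1]})$.
   Context: A represented space $\mathbf X=(X,\delta_X)$ is a set $X$ with a partial surjection $\delta_X:\subseteq\mathbb N^{\mathbb N}\to X$ (the symbol $\subseteq$ marks possibly partial functions). A multi-valued function $f:\subseteq\mathbf X\rightrightarrows\mathbf Y$ assigns to each $x\in\mathrm{dom}(f)\subseteq X$ a nonempty set $f(x)\subseteq Y$. Composition: $z\in(f\circ g)(x)$ iff $g(x)\subseteq\mathrm{dom}(f)$ and $z\in f(y)$ for some $y\in g(x)$ (with $x\in\mathrm{dom}(g)$). $F:\subseteq\mathbb N^{\mathbb N}\to\mathbb N^{\mathbb N}$ is a realizer of $f$, $F\vdash f$, if $\delta_YF(p)\in f\delta_X(p)$ for all $p\in\mathrm{dom}(f\delta_X)$. $f\leq_{\mathrm W}g$ iff there are computable $K,H:\subseteq\mathbb N^{\mathbb N}\to\mathbb N^{\mathbb N}$ with $K\langle\mathrm{id},GH\rangle\vdash f$ for all $G\vdash g$; $\equiv_{\mathrm W}$ is the induced equivalence. Space $\mathcal M(\mathbf X,\mathbf Y)$: fix a universal Turing machine; $\Phi_p:\subseteq\mathbb N^{\mathbb N}\to\mathbb N^{\mathbb N}$ is the partial function it computes with first input $p$, i.e. $\Phi_p(q)=r$ iff on input $\langle p,q\rangle$ it produces the infinite output $r$. Let $\delta_X^{\mathrm{cyl}}\langle p,q\rangle:=\delta_X(p)$, $\Phi_p^{\mathbf X,\mathbf Y}:=\delta_Y\circ\Phi_p\circ(\delta_X^{\mathrm{cyl}})^{-1}$.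 $\mathcal M(\mathbf X,\mathbf Y)$ is the represented space of all $\Phi_p^{\mathbf X,\mathbf Y}$, with $p$ as a name. Implication: for $f:\subseteq\mathbf U\rightrightarrows\mathbf V$ and $g:\subseteq\mathbf X\rightrightarrows\mathbf Y$ with $\mathrm{dom}(g)\neq\emptyset$, $(g\rightarrow f):\subseteq\mathbf U\rightrightarrows\mathcal M(\mathbf Y,\mathbf V)\times\mathbf X$ has domain $\mathrm{dom}(f)$ and $(H,x)\in(g\rightarrow f)(u)$ iff $(H\circ g)(x)\subseteq f(u)$ (where $x\in\mathrm{dom}(H\circ g)$). For a represented space $\mathbf X$ (with the final topology of its representation), $\mathcal A(\mathbf X)$ is the space of closed subsets of $\mathbf X$ represented by negative information: a name of $A$ is a name of the open set $X\setminus A$; e.g. for $\{0,1\}$ an enumeration of the complement, and for $[0,1]$ (with the standard Cauchy representation) an enumeration of relatively open rational intervals whose union is the complement. Closed choice $\mathsf C_{\mathbf X}:\subseteq\mathcal A(\mathbf X)\rightrightarrows\mathbf X$, $A\mapsto A$, is defined for all nonempty $A\in\mathcal A(\mathbf X)$. The multi-valued function $\frac12\mathsf C_{[0,1]}:\subseteq\mathcal A([0,1])\rightrightarrows[0,1]\times[0,1]$ takes as input a nonempty closed set $A\in\mathcal A([0,1])$ and admits as outputs exactly the pairs $(x_0,x_1)$ with $x_0\in A$ or $x_1\in A$. *)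

theory Defs
  imports Complex_Main "HOL-Library.Countable"
begin

section \<open>Computability on Baire space\<close>

type_synonym baire = "nat \<Rightarrow> nat"

text \<open>
  The model of computation is Kleene's: the partial recursive functions relative to a sequence
  \<^term>\<open>p :: nat \<Rightarrow> nat\<close>, whose entries a program reads by \<open>Query\<close>. A program computes the
  partial function on Baire space that sends \<^term>\<open>p\<close> to the sequence of its values at
  0, 1, 2, and so on, relative to \<^term>\<open>p\<close>; these are the functions computed by Type-2 Turing machines
  with input \<^term>\<open>p\<close>, with infinite output exactly if all these values are defined.
\<close>

datatype prog =
    Zero
  | Succ
  | Proj nat
  | Query
  | Comp prog "prog list"
  | PrimRec prog prog
  | Mu prog

inductive evals :: "baire \<Rightarrow> prog \<Rightarrow> nat list \<Rightarrow> nat \<Rightarrow> bool" for p :: baire where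
  evals_Zero: "evals p Zero xs 0"
| evals_Succ: "evals p Succ (x # xs) (Suc x)"
| evals_Proj: "i < length xs \<Longrightarrow> evals p (Proj i) xs (xs ! i)"
| evals_Query: "evals p Query (x # xs) (p x)"
| evals_Comp: "list_all2 (\<lambda>g y. evals p g xs y) gs ys \<Longrightarrow> evals p f ys z \<Longrightarrow> evals p (Comp f gs) xs z"
| evals_PrimRec_0: "evals p f xs y \<Longrightarrow> evals p (PrimRec f g) (0 # xs) y"
| evals_PrimRec_Suc:
    "evals p (PrimRec f g) (n # xs) y \<Longrightarrow> evals p g (n # y # xs) z \<Longrightarrow>
     evals p (PrimRec f g) (Suc n # xs) z"
| evals_Mu:
    "evals p f (n # xs) 0 \<Longrightarrow> (\<forall>m<n. \<exists>y. evals p f (m # xs) (Suc y)) \<Longrightarrow> evals p (Mu f) xs n"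

inductive_cases evals_ZeroE: "evals p Zero xs y"
inductive_cases evals_SuccE: "evals p Succ xs y"
inductive_cases evals_ProjE: "evals p (Proj i) xs y"
inductive_cases evals_QueryE: "evals p Query xs y"
inductive_cases evals_CompE: "evals p (Comp f gs) xs y"
inductive_cases evals_PrimRec_0E: "evals p (PrimRec f g) (0 # xs) y"
inductive_cases evals_PrimRec_SucE: "evals p (PrimRec f g) (Suc n # xs) y"
inductive_cases evals_MuE: "evals p (Mu f) xs y"

lemma evals_unique: "evals p f xs y \<Longrightarrow> evals p f xs z \<Longrightarrow> y = z"
proof (induction arbitrary: z rule: evals.induct)
  case (evals_Zero xs)
  from evals_Zero.prems show ?case by (rule evals_ZeroE) simp
next
  case (evals_Succ x xs)
  from evals_Succ.prems show ?case by (rule evals_SuccE) simp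
next
  case (evals_Proj i xs)
  from evals_Proj.prems show ?case by (rule evals_ProjE) simp
next
  case (evals_Query x xs)
  from evals_Query.prems show ?case by (rule evals_QueryE) simp
next
  case (evals_Comp xs gs ys f w)
  from evals_Comp.prems obtain ys' where
    ys': "list_all2 (\<lambda>g y. evals p g xs y) gs ys'" "evals p f ys' z"
    by (rule evals_CompE)
  have "ys = ys'"
  proof (rule nth_equalityI)
    show len: "length ys = length ys'"
      using list_all2_lengthD[OF evals_Comp.IH(1)] list_all2_lengthD[OF ys'(1)] by simp
    fix i assume i: "i < length ys"
    have "evals p (gs ! i) xs (ys' ! i)"
      by (rule list_all2_nthD2[OF ys'(1)]) (use i len in simp)
    moreover have "\<forall>w. evals p (gs ! i) xs w \<longrightarrow> ys ! i = w"
      using list_all2_nthD2[OF evals_Comp.IH(1) i] by simp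
    ultimately show "ys ! i = ys' ! i" by simp
  qed
  with ys'(2) have "evals p f ys z" by simp
  then show ?case by (rule evals_Comp.IH(2))
next
  case (evals_PrimRec_0 f xs y g)
  from evals_PrimRec_0.prems have "evals p f xs z" by (rule evals_PrimRec_0E)
  then show ?case by (rule evals_PrimRec_0.IH)
next
  case (evals_PrimRec_Suc f g n xs y w)
  from evals_PrimRec_Suc.prems obtain y' where
    "evals p (PrimRec f g) (n # xs) y'" "evals p g (n # y' # xs) z"
    by (rule evals_PrimRec_SucE)
  with evals_PrimRec_Suc.IH show ?case by simp
next
  case (evals_Mu f n xs)
  from evals_Mu.prems obtain
    z: "evals p f (z # xs) 0" "\<forall>m<z. \<exists>y. evals p f (m # xs) (Suc y)"
    by (rule evals_MuE)
  show ?case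
  proof (rule linorder_cases)
    assume "n < z"
    with z(2) obtain y where "evals p f (n # xs) (Suc y)" by auto
    from evals_Mu.IH(1)[OF this] show ?thesis by simp
  next
    assume "z < n"
    with evals_Mu.IH(2) obtain y where "\<forall>w. evals p f (z # xs) w \<longrightarrow> Suc y = w" by auto
    with z(1) show ?thesis by auto
  qed simp
qed

definition run :: "prog \<Rightarrow> baire \<rightharpoonup> baire" where
  "run e p =
     (if \<exists>r. \<forall>n. evals p e [n] (r n) then Some (THE r. \<forall>n. evals p e [n] (r n)) else None)"

lemma run_eq_Some_iff: "run e p = Some r \<longleftrightarrow> (\<forall>n. evals p e [n] (r n))"
proof -
  have the: "(THE r. \<forall>n. evals p e [n] (r n)) = s" if s: "\<forall>n. evals p e [n] (s n)" for s
  proof (rule the_equality[where P = "\<lambda>r. \<forall>n. evals p e [n] (r n)", OF s])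
    fix t assume t: "\<forall>n. evals p e [n] (t n)"
    show "t = s" by (rule ext, rule evals_unique[OF t[rule_format] s[rule_format]])
  qed
  show ?thesis
  proof (cases "\<exists>r. \<forall>n. evals p e [n] (r n)")
    case True
    then obtain s where s: "\<forall>n. evals p e [n] (s n)" ..
    then have run: "run e p = Some s" unfolding run_def using the[OF s] by (simp only: True if_True)
    show ?thesis
    proof
      assume "run e p = Some r"
      with run s show "\<forall>n. evals p e [n] (r n)" by simp
    next
      assume "\<forall>n. evals p e [n] (r n)"
      from the[OF this] the[OF s] run show "run e p = Some r" by (simp only:)
    qed
  next
    case False
    then have "run e p = None" unfolding run_def by (simp only: if_False)
    with False show ?thesis by auto
  qed
qed

text \<open>As usual, a restriction of the function computed by a program also counts as computable.\<close>

definition computable :: "(baire \<rightharpoonup> baire) \<Rightarrow> bool" where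
  "computable F \<longleftrightarrow> (\<exists>e. F \<subseteq>\<^sub>m run e)"

definition pair :: "baire \<Rightarrow> baire \<Rightarrow> baire" where
  "pair p q n = (if even n then p (n div 2) else q (n div 2))"

definition fst_part :: "baire \<Rightarrow> baire" where
  "fst_part r n = r (2 * n)"

definition snd_part :: "baire \<Rightarrow> baire" where
  "snd_part r n = r (2 * n + 1)"

lemma pair_parts [simp]:
  "fst_part (pair p q) = p" "snd_part (pair p q) = q" "pair (fst_part r) (snd_part r) = r"
proof -
  show "fst_part (pair p q) = p" by (rule ext) (simp add: pair_def fst_part_def)
  show "snd_part (pair p q) = q" by (rule ext) (simp add: pair_def snd_part_def)
  show "pair (fst_part r) (snd_part r) = r"
    by (rule ext) (simp add: pair_def fst_part_def snd_part_def)
qed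

text \<open>
  A program \<open>u\<close> is a universal machine if every program can be run by \<open>u\<close>, with the parameter
  \<open>p\<close> of the given program passed to \<open>u\<close> in a computable way as (part of) the first input. For
  instance, \<open>s p\<close> may be a code of \<open>e\<close> followed by \<open>p\<close>.
\<close>

definition universal :: "prog \<Rightarrow> bool" where
  "universal u \<longleftrightarrow>
     (\<forall>e. \<exists>s. computable (\<lambda>p. Some (s p)) \<and> (\<forall>p q. run u (pair (s p) q) = run e (pair p q)))"

definition Phi :: "prog \<Rightarrow> baire \<Rightarrow> baire \<rightharpoonup> baire" where
  "Phi u p q = run u (pair p q)"


section \<open>Represented spaces and multi-valued functions\<close>

text \<open>
  A represented space is given by its representation \<open>d\<close>; its underlying set is \<^term>\<open>ran d\<close>, so that
  \<open>d\<close> is a partial surjection onto it.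
\<close>

type_synonym 'a rep = "baire \<rightharpoonup> 'a"

definition prod_rep :: "'a rep \<Rightarrow> 'b rep \<Rightarrow> ('a \<times> 'b) rep" where
  "prod_rep d d' r =
     (case (d (fst_part r), d' (snd_part r)) of (Some x, Some y) \<Rightarrow> Some (x, y) | _ \<Rightarrow> None)"

text \<open>A multi-valued function has the value \<^term>\<open>{}\<close> exactly at the points outside its domain.\<close>

type_synonym ('a, 'b) mvf = "'a \<Rightarrow> 'b set"

definition mdom :: "('a, 'b) mvf \<Rightarrow> 'a set" where
  "mdom f = {x. f x \<noteq> {}}"

definition mcomp :: "('b, 'c) mvf \<Rightarrow> ('a, 'b) mvf \<Rightarrow> ('a, 'c) mvf" where
  "mcomp f g x = {z. x \<in> mdom g \<and> g x \<subseteq> mdom f \<and> (\<exists>y\<in>g x. z \<in> f y)}"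

definition mvf_of :: "('a \<rightharpoonup> 'b) \<Rightarrow> ('a, 'b) mvf" where
  "mvf_of F x = set_option (F x)"

definition minverse :: "('a \<rightharpoonup> 'b) \<Rightarrow> ('b, 'a) mvf" where
  "minverse F y = {x. F x = Some y}"

record ('a, 'b) problem =
  src :: "'a rep"
  tgt :: "'b rep"
  rel :: "('a, 'b) mvf"

definition realizes :: "(baire \<rightharpoonup> baire) \<Rightarrow> ('a, 'b) problem \<Rightarrow> bool" where
  "realizes F f \<longleftrightarrow>
     (\<forall>p x. src f p = Some x \<and> x \<in> mdom (rel f) \<longrightarrow>
        (\<exists>r y. F p = Some r \<and> tgt f r = Some y \<and> y \<in> rel f x))"

definition weihrauch_le :: "('a, 'b) problem \<Rightarrow> ('c, 'd) problem \<Rightarrow> bool"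
    (infix "\<le>\<^sub>W" 50) where
  "f \<le>\<^sub>W g \<longleftrightarrow>
     (\<exists>K H. computable K \<and> computable H \<and>
        (\<forall>G. realizes G g \<longrightarrow>
           realizes (\<lambda>p. case (G \<circ>\<^sub>m H) p of Some r \<Rightarrow> K (pair p r) | None \<Rightarrow> None) f))"

definition weihrauch_equiv :: "('a, 'b) problem \<Rightarrow> ('c, 'd) problem \<Rightarrow> bool"
    (infix "\<equiv>\<^sub>W" 50) where
  "f \<equiv>\<^sub>W g \<longleftrightarrow> f \<le>\<^sub>W g \<and> g \<le>\<^sub>W f"


section \<open>The space of multi-valued functions and the implication\<close>

definition cyl :: "'a rep \<Rightarrow> 'a rep" where
  "cyl d r = d (fst_part r)"

text \<open>\<open>Phi_mvf u d d' p\<close> is the composition of \<open>d'\<close>, \<open>Phi u p\<close> and the inverse of \<open>cyl d\<close>.\<close>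

definition Phi_mvf :: "prog \<Rightarrow> 'a rep \<Rightarrow> 'b rep \<Rightarrow> baire \<Rightarrow> ('a, 'b) mvf" where
  "Phi_mvf u d d' p = mcomp (mvf_of d') (mcomp (mvf_of (Phi u p)) (minverse (cyl d)))"

definition mvf_rep :: "prog \<Rightarrow> 'a rep \<Rightarrow> 'b rep \<Rightarrow> ('a, 'b) mvf rep" where
  "mvf_rep u d d' p = Some (Phi_mvf u d d' p)"

text \<open>The implication \<open>g \<rightarrow> f\<close> is meant for problems \<open>g\<close> with nonempty domain.\<close>

definition implication ::
    "prog \<Rightarrow> ('c, 'd) problem \<Rightarrow> ('a, 'b) problem \<Rightarrow> ('a, ('d, 'b) mvf \<times> 'c) problem" where
  "implication u g f =
     \<lparr>src = src f,
      tgt = prod_rep (mvf_rep u (tgt g) (tgt f)) (src g),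
      rel = (\<lambda>v. {(H, x). v \<in> mdom (rel f) \<and>
                          H \<in> ran (mvf_rep u (tgt g) (tgt f)) \<and> x \<in> ran (src g) \<and>
                          x \<in> mdom (mcomp H (rel g)) \<and> mcomp H (rel g) x \<subseteq> rel f v})\<rparr>"


section \<open>The spaces \<open>{0, 1}\<close> and \<open>[0, 1]\<close> and closed choice\<close>

definition two_rep :: "nat rep" where
  "two_rep p = (if p 0 \<in> {0, 1} then Some (p 0) else None)"

definition cauchy_name :: "baire \<Rightarrow> real \<Rightarrow> bool" where
  "cauchy_name p x \<longleftrightarrow>
     (let q = (\<lambda>n. real_of_rat (nat_to_rat_surj (p n)))
      in (\<forall>i j. i < j \<longrightarrow> \<bar>q i - q j\<bar> \<le> 1 / 2 ^ i) \<and> q \<longlonglongrightarrow> x)"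

definition unit_rep :: "real rep" where
  "unit_rep p =
     (if \<exists>x\<in>{0..1}. cauchy_name p x then Some (THE x. cauchy_name p x) else None)"

text \<open>
  A sequence enumerates the numbers \<open>n\<close> for which \<open>Suc n\<close> occurs in it; the entry 0 carries no
  information, so that the empty set can be enumerated, too.
\<close>

definition enumerated :: "baire \<Rightarrow> nat set" where
  "enumerated p = {n. Suc n \<in> range p}"

definition two_open_rep :: "nat set rep" where
  "two_open_rep p = (if enumerated p \<subseteq> {0, 1} then Some (enumerated p) else None)"

definition rat_interval :: "nat \<Rightarrow> real set" where
  "rat_interval n =
     (case prod_decode n of (i, j) \<Rightarrow>
        {real_of_rat (nat_to_rat_surj i)<..<real_of_rat (nat_to_rat_surj j)})"

definition unit_open_rep :: "real set rep" where
  "unit_open_rep p = Some ({0..1} \<inter> (\<Union>n\<in>enumerated p. rat_interval n))"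

text \<open>Negative information: a name of an open set is a name of its complement in \<^term>\<open>ran d\<close>.\<close>

definition closed_rep :: "'a rep \<Rightarrow> 'a set rep \<Rightarrow> 'a set rep" where
  "closed_rep d d_open p = map_option (\<lambda>V. ran d - V) (d_open p)"

definition closed_choice :: "'a rep \<Rightarrow> 'a set rep \<Rightarrow> ('a set, 'a) problem" where
  "closed_choice d d_open =
     \<lparr>src = closed_rep d d_open,
      tgt = d,
      rel = (\<lambda>A. if A \<in> ran (closed_rep d d_open) then A else {})\<rparr>"

definition C_two :: "(nat set, nat) problem" where
  "C_two = closed_choice two_rep two_open_rep"

definition C_unit :: "(real set, real) problem" where
  "C_unit = closed_choice unit_rep unit_open_rep"

definition half_C_unit :: "(real set, real \<times> real) problem" where
  "half_C_unit =
     \<lparr>src = closed_rep unit_rep unit_open_rep,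
      tgt = prod_rep unit_rep unit_rep,
      rel = (\<lambda>A. {(x0, x1). A \<in> ran (closed_rep unit_rep unit_open_rep) \<and> A \<noteq> {} \<and>
                            x0 \<in> {0..1} \<and> x1 \<in> {0..1} \<and> (x0 \<in> A \<or> x1 \<in> A)})\<rparr>"

lemma unit_rep_eq_Some_iff: "unit_rep p = Some x \<longleftrightarrow> x \<in> {0..1} \<and> cauchy_name p x"
proof -
  have u: "y = z" if "cauchy_name p y" "cauchy_name p z" for y z
    using that by (auto simp: cauchy_name_def Let_def intro: LIMSEQ_unique)
  have "(THE y. cauchy_name p y) = x" if "cauchy_name p x" for x
    using that u by (intro the_equality) auto
  then show ?thesis using u by (auto simp: unit_rep_def)
qed

lemma ran_unit_rep: "ran unit_rep = {0..1}"
proof (intro equalityI subsetI)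
  fix x assume "x \<in> ran unit_rep"
  then show "x \<in> {0..1}" by (auto simp: ran_def unit_rep_eq_Some_iff)
next
  fix x :: real assume x: "x \<in> {0..1}"
  have "\<exists>k. \<bar>real_of_rat (nat_to_rat_surj k) - x\<bar> < 1 / 2 ^ Suc n" for n
  proof -
    obtain r where "x < real_of_rat r" "real_of_rat r < x + 1 / 2 ^ Suc n"
      using of_rat_dense[of x "x + 1 / 2 ^ Suc n"] by auto
    moreover obtain k where "r = nat_to_rat_surj k"
      using surj_nat_to_rat_surj unfolding surj_def by blast
    ultimately show ?thesis by (intro exI[of _ k]) auto
  qed
  then have "\<exists>p. \<forall>n. \<bar>real_of_rat (nat_to_rat_surj (p n)) - x\<bar> < 1 / 2 ^ Suc n"
    by (intro choice) blast
  then obtain p where p: "\<bar>real_of_rat (nat_to_rat_surj (p n)) - x\<bar> < 1 / 2 ^ Suc n" for n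
    by blast
  define q where "q n = real_of_rat (nat_to_rat_surj (p n))" for n
  have "\<bar>q i - q j\<bar> \<le> 1 / 2 ^ i" if "i < j" for i j
  proof -
    have "(1::real) / 2 ^ Suc j \<le> 1 / 2 ^ Suc i"
      using that by (intro divide_left_mono power_increasing) auto
    moreover have "(1::real) / 2 ^ i = 1 / 2 ^ Suc i + 1 / 2 ^ Suc i" by simp
    ultimately show ?thesis using p[of i] p[of j] unfolding q_def by linarith
  qed
  moreover have "q \<longlonglongrightarrow> x"
  proof (rule LIM_zero_cancel)
    have "(\<lambda>n. 1 / 2 ^ Suc n :: real) \<longlonglongrightarrow> 0"
      using LIMSEQ_Suc[OF LIMSEQ_inverse_realpow_zero[of 2]] by (simp add: field_simps)
    then have "(\<lambda>n. \<bar>q n - x\<bar>) \<longlonglongrightarrow> 0"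
      by (rule real_tendsto_sandwich[OF _ _ tendsto_const, rotated 2])
         (use p in \<open>auto simp: q_def less_imp_le simp del: power_Suc\<close>)
    then show "(\<lambda>n. q n - x) \<longlonglongrightarrow> 0" by (rule tendsto_rabs_zero_cancel)
  qed
  ultimately have "cauchy_name p x"
    by (auto simp: cauchy_name_def q_def[abs_def] Let_def)
  with x show "x \<in> ran unit_rep"
    by (auto simp: ran_def unit_rep_eq_Some_iff)
qed

lemma ran_two_rep: "ran two_rep = {0, 1}"
proof -
  have "two_rep (\<lambda>_. 0) = Some 0" "two_rep (\<lambda>_. 1) = Some 1"
    by (simp_all add: two_rep_def)
  then have "{0, 1} \<subseteq> ran two_rep" by (auto intro: ranI)
  moreover have "ran two_rep \<subseteq> {0, 1}"
    by (auto simp: ran_def two_rep_def split: if_splits)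
  ultimately show ?thesis by (rule equalityI[rotated])
qed

text \<open>The points of the space of closed subsets of \<open>[0, 1]\<close> are indeed all closed subsets.\<close>

lemma ran_closed_rep_unit:
  "ran (closed_rep unit_rep unit_open_rep) = {A. A \<subseteq> {0..1} \<and> closed A}"
proof (intro equalityI subsetI)
  fix A assume "A \<in> ran (closed_rep unit_rep unit_open_rep)"
  then obtain p where "A = {0..1} - {0..1} \<inter> (\<Union>n\<in>enumerated p. rat_interval n)"
    by (auto simp: ran_def closed_rep_def unit_open_rep_def ran_unit_rep[unfolded ran_def])
  then have A: "A = {0..1} - (\<Union>n\<in>enumerated p. rat_interval n)" by blast
  have "open (rat_interval n)" for n
    by (simp add: rat_interval_def split: prod.split)
  then have "closed A" unfolding A by (intro closed_Diff open_UN) auto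
  with A show "A \<in> {A. A \<subseteq> {0..1} \<and> closed A}" by blast
next
  fix A :: "real set" assume "A \<in> {A. A \<subseteq> {0..1} \<and> closed A}"
  then have A: "A \<subseteq> {0..1}" "closed A" by auto
  define p where "p n = (if rat_interval n \<inter> A = {} then Suc n else 0)" for n
  have p: "n \<in> enumerated p \<longleftrightarrow> rat_interval n \<inter> A = {}" for n
  proof
    assume "n \<in> enumerated p"
    then obtain m where "Suc n = p m" by (auto simp: enumerated_def)
    then show "rat_interval n \<inter> A = {}" by (simp add: p_def split: if_splits)
  next
    assume "rat_interval n \<inter> A = {}"
    then have "p n = Suc n" by (simp add: p_def)
    then show "n \<in> enumerated p" by (auto simp: enumerated_def intro: range_eqI[of _ _ n])
  qed
  have "\<exists>n\<in>enumerated p. x \<in> rat_interval n" if x: "x \<notin> A" for x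
  proof -
    have "open (- A)" using A(2) by (simp add: open_Compl)
    with x obtain e where e: "e > 0" "\<And>y. dist y x < e \<Longrightarrow> y \<in> - A"
      unfolding open_dist by blast
    obtain a where a: "x - e < real_of_rat a" "real_of_rat a < x"
      using of_rat_dense[of "x - e" x] e(1) by auto
    obtain b where b: "x < real_of_rat b" "real_of_rat b < x + e"
      using of_rat_dense[of x "x + e"] e(1) by auto
    obtain i j where ij: "a = nat_to_rat_surj i" "b = nat_to_rat_surj j"
      using surj_nat_to_rat_surj unfolding surj_def by blast
    have r: "rat_interval (prod_encode (i, j)) = {real_of_rat a<..<real_of_rat b}"
      by (simp add: rat_interval_def ij)
    have "y \<notin> A" if "y \<in> {real_of_rat a<..<real_of_rat b}" for y
      using e(2)[of y] that a b by (auto simp: dist_real_def abs_less_iff)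
    then have "prod_encode (i, j) \<in> enumerated p" unfolding p r by blast
    moreover have "x \<in> rat_interval (prod_encode (i, j))" using a b by (simp add: r)
    ultimately show ?thesis by blast
  qed
  then have "- A \<subseteq> (\<Union>n\<in>enumerated p. rat_interval n)" by auto
  moreover have "(\<Union>n\<in>enumerated p. rat_interval n) \<subseteq> - A" by (auto simp: p)
  ultimately have "(\<Union>n\<in>enumerated p. rat_interval n) = - A" by (rule equalityI[rotated])
  with A(1) have "A = {0..1} - {0..1} \<inter> (\<Union>n\<in>enumerated p. rat_interval n)" by auto
  then have "closed_rep unit_rep unit_open_rep p = Some A"
    by (simp add: closed_rep_def unit_open_rep_def ran_unit_rep)
  then show "A \<in> ran (closed_rep unit_rep unit_open_rep)" by (auto simp: ran_def)
qed

end

theory Submission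
  imports Defs
begin

text \<open>
  Given two points of which at least one lies in \<open>A\<close>, the function \<open>H\<close> that maps \<open>i\<close> to the \<open>i\<close>-th point
  and the set of all \<open>i\<close> whose point lies in \<open>A\<close> solve the implication: negative information on this
  set is obtained by waiting until a point is seen inside an interval of the complement of \<open>A\<close>.
  Conversely, let \<open>(H, B)\<close> solve the implication. For both \<open>b\<close> we run \<open>H\<close> on \<open>b\<close> and wait at each output
  position until either \<open>H\<close> has produced a consistent Cauchy prefix of this length or \<open>b\<close> has been
  removed from \<open>B\<close>. In the latter case the last approximation is repeated forever, so that two
  points of \<open>[0, 1]\<close> are always produced; for \<open>b \<in> B\<close> the point is \<open>H(b) \<in> A\<close>. The parallel waiting
  needs step-bounded evaluation of programs, which is a total computable functional.
\<close>

section \<open>Total computable functionals\<close>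

definition recfun :: "nat \<Rightarrow> (baire \<Rightarrow> nat list \<Rightarrow> nat) \<Rightarrow> bool" where
  "recfun k F \<longleftrightarrow> (\<exists>e. \<forall>p xs. length xs = k \<longrightarrow> evals p e xs (F p xs))"

definition recpred :: "nat \<Rightarrow> (baire \<Rightarrow> nat list \<Rightarrow> bool) \<Rightarrow> bool" where
  "recpred k P \<longleftrightarrow> recfun k (\<lambda>p xs. of_bool (P p xs))"

named_theorems rec_intros

lemma recfun_cong:
  assumes "\<And>p xs. length xs = k \<Longrightarrow> F p xs = G p xs"
  shows "recfun k F \<longleftrightarrow> recfun k G"
  using assms unfolding recfun_def by simp

lemma recfun_comp:
  assumes "recfun (length gs) f" "\<And>g. g \<in> set gs \<Longrightarrow> recfun k g"
  shows "recfun k (\<lambda>p xs. f p (map (\<lambda>g. g p xs) gs))"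
proof -
  obtain e where e: "\<And>p xs. length xs = length gs \<Longrightarrow> evals p e xs (f p xs)"
    using assms(1) unfolding recfun_def by blast
  have "\<forall>g\<in>set gs. \<exists>e. \<forall>p xs. length xs = k \<longrightarrow> evals p e xs (g p xs)"
    using assms(2) unfolding recfun_def by blast
  then obtain c where c: "\<And>g p xs. g \<in> set gs \<Longrightarrow> length xs = k \<Longrightarrow> evals p (c g) xs (g p xs)"
    by metis
  have "evals p (Comp e (map c gs)) xs (f p (map (\<lambda>g. g p xs) gs))" if "length xs = k" for p xs
  proof (rule evals_Comp)
    show "list_all2 (\<lambda>g y. evals p g xs y) (map c gs) (map (\<lambda>g. g p xs) gs)"
      using c that by (simp add: list_all2_map1 list_all2_map2 list_all2_same)
    show "evals p e (map (\<lambda>g. g p xs) gs) (f p (map (\<lambda>g. g p xs) gs))"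
      by (rule e) simp
  qed
  then show ?thesis unfolding recfun_def by blast
qed

lemma recfun_nth [rec_intros]: "i < k \<Longrightarrow> recfun k (\<lambda>p xs. xs ! i)"
  unfolding recfun_def by (intro exI[of _ "Proj i"]) (auto intro: evals_Proj)

lemma recfun_comp1:
  assumes "recfun 1 (\<lambda>p xs. f p (xs ! 0))" "recfun k a"
  shows "recfun k (\<lambda>p xs. f p (a p xs))"
  using recfun_comp[of "[a]" "\<lambda>p xs. f p (xs ! 0)" k] assms by simp

lemma recfun_comp2:
  assumes "recfun 2 (\<lambda>p xs. f p (xs ! 0) (xs ! 1))" "recfun k a" "recfun k b"
  shows "recfun k (\<lambda>p xs. f p (a p xs) (b p xs))"
  using recfun_comp[of "[a, b]" "\<lambda>p xs. f p (xs ! 0) (xs ! 1)" k] assms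
  by (auto simp: numeral_2_eq_2)

lemma recpred_comp2:
  assumes "recpred 2 (\<lambda>p xs. f p (xs ! 0) (xs ! 1))" "recfun k a" "recfun k b"
  shows "recpred k (\<lambda>p xs. f p (a p xs) (b p xs))"
  using assms unfolding recpred_def by (rule recfun_comp2)

lemma recpred_comp4:
  assumes "recpred 4 (\<lambda>p xs. f p (xs ! 0) (xs ! 1) (xs ! 2) (xs ! 3))"
    "recfun k a" "recfun k b" "recfun k c" "recfun k d"
  shows "recpred k (\<lambda>p xs. f p (a p xs) (b p xs) (c p xs) (d p xs))"
  using recfun_comp[of "[a, b, c, d]" "\<lambda>p xs. of_bool (f p (xs ! 0) (xs ! 1) (xs ! 2) (xs ! 3))" k] assms
  unfolding recpred_def by (auto simp: eval_nat_numeral)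

lemma recfun_tl:
  assumes "recfun k f"
  shows "recfun (Suc k) (\<lambda>p xs. f p (tl xs))"
proof -
  have "recfun (Suc k) (\<lambda>p xs. f p (map (\<lambda>g. g p xs) (map (\<lambda>i p xs. xs ! Suc i) [0..<k])))"
    using assms by (intro recfun_comp) (auto intro: recfun_nth)
  moreover have "map (\<lambda>g. g p xs) (map (\<lambda>i p xs. xs ! Suc i) [0..<k]) = tl xs"
    if "length xs = Suc k" for p :: baire and xs :: "nat list"
    using that by (intro nth_equalityI) (auto simp: nth_tl)
  ultimately show ?thesis by (simp cong: recfun_cong)
qed

lemma recfun_hd [rec_intros]: "recfun (Suc k) (\<lambda>p xs. hd xs)"
proof -
  have "recfun (Suc k) (\<lambda>p xs. xs ! 0)" by (simp add: recfun_nth)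
  moreover have "hd xs = xs ! 0" if "length xs = Suc k" for xs :: "nat list"
    using that by (cases xs) auto
  ultimately show ?thesis by (simp cong: recfun_cong)
qed

lemmas recfun_vars [rec_intros] =
  recfun_tl[OF recfun_hd] recfun_tl[OF recfun_nth]
  recfun_tl[OF recfun_tl[OF recfun_hd]] recfun_tl[OF recfun_tl[OF recfun_nth]]

lemma recfun_Suc [rec_intros]: "recfun k f \<Longrightarrow> recfun k (\<lambda>p xs. Suc (f p xs))"
proof (rule recfun_comp1[where f = "\<lambda>p n. Suc n"])
  show "recfun 1 (\<lambda>p xs. Suc (xs ! 0))"
    unfolding recfun_def
    by (intro exI[of _ Succ]) (auto simp: length_Suc_conv intro: evals_Succ)
qed

lemma recfun_query [rec_intros]: "recfun k f \<Longrightarrow> recfun k (\<lambda>p xs. p (f p xs))"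
proof (rule recfun_comp1[where f = "\<lambda>p n. p n"])
  show "recfun 1 (\<lambda>p xs. p (xs ! 0))"
    unfolding recfun_def
    by (intro exI[of _ Query]) (auto simp: length_Suc_conv intro: evals_Query)
qed

lemma recfun_const [rec_intros]: "recfun k (\<lambda>p xs. c)"
proof (induction c)
  case 0
  show ?case unfolding recfun_def by (intro exI[of _ Zero]) (auto intro: evals_Zero)
next
  case (Suc c)
  then show ?case by (rule recfun_Suc)
qed

lemma recfun_rec_nat [rec_intros]:
  assumes "recfun k n" "recfun k f"
    and "recfun (Suc (Suc k)) (\<lambda>p ys. g p (hd ys) (hd (tl ys)) (tl (tl ys)))"
  shows "recfun k (\<lambda>p xs. rec_nat (f p xs) (\<lambda>i y. g p i y xs) (n p xs))"
proof -
  obtain ef where ef: "\<And>p xs. length xs = k \<Longrightarrow> evals p ef xs (f p xs)"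
    using assms(2) unfolding recfun_def by blast
  obtain eg where
    eg: "\<And>p ys. length ys = Suc (Suc k) \<Longrightarrow> evals p eg ys (g p (hd ys) (hd (tl ys)) (tl (tl ys)))"
    using assms(3) unfolding recfun_def by blast
  let ?h = "\<lambda>p xs. rec_nat (f p (tl xs)) (\<lambda>i y. g p i y (tl xs)) (hd xs)"
  have *: "evals p (PrimRec ef eg) (m # xs) (?h p (m # xs))" if "length xs = k" for p m xs
  proof (induction m)
    case 0
    show ?case by (simp add: ef evals_PrimRec_0 that)
  next
    case (Suc m)
    show ?case
      by (rule evals_PrimRec_Suc[OF Suc]) (use eg[of "m # _ # xs"] that in simp)
  qed
  have h: "recfun (Suc k) ?h"
    unfolding recfun_def by (rule exI[of _ "PrimRec ef eg"]) (use * in \<open>auto simp: length_Suc_conv\<close>)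
  let ?vs = "n # map (\<lambda>i p xs. xs ! i) [0..<k]"
  have "recfun k (\<lambda>p xs. ?h p (map (\<lambda>g. g p xs) ?vs))"
    by (rule recfun_comp) (use h assms(1) in \<open>auto intro: recfun_nth\<close>)
  moreover have "map (\<lambda>g. g p xs) ?vs = n p xs # xs" if "length xs = k" for p xs
    using that by (auto intro: nth_equalityI)
  ultimately show ?thesis by (simp cong: recfun_cong)
qed

lemma recfun_add [rec_intros]:
  assumes "recfun k f" "recfun k g"
  shows "recfun k (\<lambda>p xs. f p xs + g p xs)"
proof -
  have "m + n = rec_nat m (\<lambda>i y. Suc y) n" for m n by (induction n) auto
  with assms show ?thesis by (simp only:) (intro rec_intros; simp)
qed

lemma recfun_mult [rec_intros]:
  assumes "recfun k f" "recfun k g"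
  shows "recfun k (\<lambda>p xs. f p xs * g p xs)"
proof (rule recfun_comp2[OF _ assms])
  have "m * n = rec_nat 0 (\<lambda>i y. y + m) n" for m n by (induction n) auto
  then show "recfun 2 (\<lambda>p xs. xs ! 0 * xs ! 1)" by (simp only:) (intro rec_intros; simp)
qed

lemma recfun_power [rec_intros]:
  assumes "recfun k f" "recfun k g"
  shows "recfun k (\<lambda>p xs. f p xs ^ g p xs)"
proof (rule recfun_comp2[OF _ assms])
  have "m ^ n = rec_nat 1 (\<lambda>i y. y * m) n" for m n :: nat by (induction n) auto
  then show "recfun 2 (\<lambda>p xs. (xs ! 0) ^ (xs ! 1))" by (simp only:) (intro rec_intros; simp)
qed

lemma recfun_diff [rec_intros]:
  assumes "recfun k f" "recfun k g"
  shows "recfun k (\<lambda>p xs. f p xs - g p xs)"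
proof (rule recfun_comp2[OF _ assms])
  have pred: "n - 1 = rec_nat 0 (\<lambda>i y. i) n" for n by (cases n) auto
  have "recfun 1 (\<lambda>p xs. xs ! 0 - 1)" unfolding pred by (intro rec_intros; simp)
  then have p: "recfun k f \<Longrightarrow> recfun k (\<lambda>p xs. f p xs - 1)" for k f by (rule recfun_comp1)
  have "recfun 2 (\<lambda>p xs. rec_nat (xs ! 0) (\<lambda>i y. y - 1) (xs ! 1))"
    by (intro rec_intros p; simp)
  moreover have "rec_nat m (\<lambda>i y. y - 1) n = m - n" for m n by (induction n) auto
  ultimately show "recfun 2 (\<lambda>p xs. xs ! 0 - xs ! 1)" by (simp only:)
qed

lemma recfun_of_bool [rec_intros]: "recpred k P \<Longrightarrow> recfun k (\<lambda>p xs. of_bool (P p xs))"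
  by (simp add: recpred_def)

lemma recfun_if [rec_intros]:
  assumes "recpred k P" "recfun k f" "recfun k g"
  shows "recfun k (\<lambda>p xs. if P p xs then f p xs else g p xs)"
proof -
  have "(if P p xs then f p xs else g p xs) =
      of_bool (P p xs) * f p xs + (1 - of_bool (P p xs)) * g p xs" for p xs by simp
  then show ?thesis using assms by (simp only:) (intro rec_intros)
qed

lemma recpred_not [rec_intros]: "recpred k P \<Longrightarrow> recpred k (\<lambda>p xs. \<not> P p xs)"
proof -
  assume "recpred k P"
  then have "recfun k (\<lambda>p xs. 1 - of_bool (P p xs))" by (intro rec_intros)
  moreover have "of_bool (\<not> P p xs) = 1 - (of_bool (P p xs) :: nat)" for p xs by simp
  ultimately show ?thesis unfolding recpred_def by (simp only:)
qed

lemma recpred_conj [rec_intros]: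
  "recpred k P \<Longrightarrow> recpred k Q \<Longrightarrow> recpred k (\<lambda>p xs. P p xs \<and> Q p xs)"
  unfolding recpred_def of_bool_conj by (rule recfun_mult)

lemma recpred_disj [rec_intros]:
  assumes "recpred k P" "recpred k Q"
  shows "recpred k (\<lambda>p xs. P p xs \<or> Q p xs)"
proof -
  have "recpred k (\<lambda>p xs. \<not> (\<not> P p xs \<and> \<not> Q p xs))" using assms by (intro rec_intros)
  then show ?thesis by simp
qed

lemma recpred_imp [rec_intros]:
  assumes "recpred k P" "recpred k Q"
  shows "recpred k (\<lambda>p xs. P p xs \<longrightarrow> Q p xs)"
  unfolding imp_conv_disj using assms by (intro rec_intros)

lemma recpred_const: "recpred k (\<lambda>p xs. c)"
  unfolding recpred_def by (rule recfun_const)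

lemma recpred_if [rec_intros]:
  assumes "recpred k P" "recpred k Q" "recpred k R"
  shows "recpred k (\<lambda>p xs. if P p xs then Q p xs else R p xs)"
  unfolding if_bool_eq_conj using assms by (intro rec_intros)

lemma recpred_eq_0:
  assumes "recfun k f"
  shows "recpred k (\<lambda>p xs. f p xs = 0)"
proof -
  have "of_bool (f p xs = 0) = 1 - f p xs" for p xs by simp
  then show ?thesis unfolding recpred_def using assms by (simp only:) (intro rec_intros)
qed

lemma recpred_le [rec_intros]:
  assumes "recfun k f" "recfun k g"
  shows "recpred k (\<lambda>p xs. f p xs \<le> g p xs)"
proof -
  have "recpred k (\<lambda>p xs. f p xs - g p xs = 0)" using assms by (intro recpred_eq_0 rec_intros)
  then show ?thesis by simp
qed

lemma recpred_less [rec_intros]: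
  assumes "recfun k f" "recfun k g"
  shows "recpred k (\<lambda>p xs. f p xs < g p xs)"
  unfolding less_eq_Suc_le using assms by (intro rec_intros)

lemma recpred_eq [rec_intros]:
  assumes "recfun k f" "recfun k g"
  shows "recpred k (\<lambda>p xs. f p xs = g p xs)"
  unfolding order_eq_iff using assms by (intro rec_intros)

definition search :: "(nat \<Rightarrow> bool) \<Rightarrow> nat \<Rightarrow> nat" where
  "search Q n = rec_nat 0 (\<lambda>i y. if Q i then Suc i else y) n"

lemma search_SucD: "search Q n = Suc i \<Longrightarrow> Q i \<and> i < n"
  by (induction n) (auto simp: search_def split: if_splits)

lemma search_eq_0_iff: "search Q n = 0 \<longleftrightarrow> (\<forall>i<n. \<not> Q i)"
  by (induction n) (auto simp: search_def less_Suc_eq)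

lemma search_eqI:
  assumes "Q i" "i < n" "\<And>j. Q j \<Longrightarrow> j = i"
  shows "search Q n = Suc i"
  using assms search_SucD[of Q n] search_eq_0_iff[of Q n] by (metis not0_implies_Suc)

lemma recfun_search [rec_intros]:
  assumes "recfun k n" "recpred (Suc k) (\<lambda>p ys. Q p (hd ys) (tl ys))"
  shows "recfun k (\<lambda>p xs. search (\<lambda>i. Q p i xs) (n p xs))"
proof -
  have "recpred (Suc (Suc k)) (\<lambda>p ys. Q p (hd ys) (tl (tl ys)))"
  proof -
    let ?vs = "(\<lambda>p ys. hd ys) # map (\<lambda>i p ys. tl (tl ys) ! i) [0..<k]"
    have "recfun (Suc (Suc k))
        (\<lambda>p ys. of_bool (Q p (hd (map (\<lambda>g. g p ys) ?vs)) (tl (map (\<lambda>g. g p ys) ?vs))))"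
      by (rule recfun_comp) (use assms(2) in \<open>auto simp: recpred_def intro: rec_intros\<close>)
    moreover have "map (\<lambda>i. tl (tl ys) ! i) [0..<k] = tl (tl ys)"
      if "length ys = Suc (Suc k)" for ys :: "nat list"
      using that by (auto intro: nth_equalityI)
    ultimately show ?thesis unfolding recpred_def by (simp add: comp_def cong: recfun_cong)
  qed
  with assms(1) show ?thesis unfolding search_def by (intro rec_intros)
qed

lemma recpred_bex [rec_intros]:
  assumes "recfun k n" "recpred (Suc k) (\<lambda>p ys. Q p (hd ys) (tl ys))"
  shows "recpred k (\<lambda>p xs. \<exists>i<n p xs. Q p i xs)"
proof -
  have "(\<exists>i<n p xs. Q p i xs) \<longleftrightarrow> \<not> search (\<lambda>i. Q p i xs) (n p xs) = 0" for p xs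
    by (auto simp: search_eq_0_iff)
  then show ?thesis using assms by (simp only:) (intro rec_intros)
qed

lemma recpred_ball [rec_intros]:
  assumes "recfun k n" "recpred (Suc k) (\<lambda>p ys. Q p (hd ys) (tl ys))"
  shows "recpred k (\<lambda>p xs. \<forall>i<n p xs. Q p i xs)"
proof -
  have "(\<forall>i<n p xs. Q p i xs) \<longleftrightarrow> search (\<lambda>i. \<not> Q p i xs) (n p xs) = 0" for p xs
    by (auto simp: search_eq_0_iff)
  then show ?thesis using assms by (simp only:) (intro rec_intros)
qed

lemma recfun_oracle:
  assumes "recfun 1 (\<lambda>p xs. S p (xs ! 0))" "recfun k F"
  shows "recfun k (\<lambda>p. F (S p))"
proof -
  obtain s where s: "\<And>p xs. length xs = 1 \<Longrightarrow> evals p s xs (S p (xs ! 0))"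
    using assms(1) unfolding recfun_def by blast
  obtain e where e: "\<And>p xs. length xs = k \<Longrightarrow> evals p e xs (F p xs)"
    using assms(2) unfolding recfun_def by blast
  have s': "evals p s [x] (S p x)" for p x using s[of "[x]" p] by simp
  have "\<exists>e'. \<forall>p xs y. evals (S p) e xs y \<longrightarrow> evals p e' xs y" for e
  proof (induction e)
    case Zero
    show ?case by (rule exI[of _ Zero]) (auto elim!: evals_ZeroE intro: evals_Zero)
  next
    case Succ
    show ?case by (rule exI[of _ Succ]) (auto elim!: evals_SuccE intro: evals_Succ)
  next
    case (Proj i)
    show ?case by (rule exI[of _ "Proj i"]) (auto elim!: evals_ProjE intro: evals_Proj)
  next
    case Query
    have "evals p (Comp s [Proj 0]) (x # xs) (S p x)" for p x xs
      using evals_Proj[of 0 "x # xs" p] s'[of p x] by (auto intro: evals_Comp)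
    then show ?case by (intro exI[of _ "Comp s [Proj 0]"]) (auto elim!: evals_QueryE)
  next
    case (Comp f gs)
    obtain f' where f': "\<And>p xs y. evals (S p) f xs y \<Longrightarrow> evals p f' xs y"
      using Comp.IH(1) by blast
    obtain c where c: "\<And>g p xs y. g \<in> set gs \<Longrightarrow> evals (S p) g xs y \<Longrightarrow> evals p (c g) xs y"
      using Comp.IH(2) by metis
    have "evals p (Comp f' (map c gs)) xs z" if "evals (S p) (Comp f gs) xs z" for p xs z
      using that
    proof (rule evals_CompE)
      fix ys assume ys: "list_all2 (\<lambda>g y. evals (S p) g xs y) gs ys" "evals (S p) f ys z"
      have "list_all2 (\<lambda>g y. evals p (c g) xs y) gs ys"
        using ys(1) unfolding list_all2_conv_all_nth using c by auto
      then show ?thesis using f'[OF ys(2)] by (auto simp: list_all2_map1 intro: evals_Comp)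
    qed
    then show ?case by blast
  next
    case (PrimRec f g)
    obtain f' where f': "\<And>p xs y. evals (S p) f xs y \<Longrightarrow> evals p f' xs y"
      using PrimRec.IH(1) by blast
    obtain g' where g': "\<And>p xs y. evals (S p) g xs y \<Longrightarrow> evals p g' xs y"
      using PrimRec.IH(2) by blast
    have rec: "evals p (PrimRec f' g') (n # xs) z"
      if "evals (S p) (PrimRec f g) (n # xs) z" for p n xs z
      using that
    proof (induction n arbitrary: z)
      case 0
      then show ?case by (auto elim!: evals_PrimRec_0E intro: evals_PrimRec_0 f')
    next
      case (Suc n)
      then show ?case by (auto elim!: evals_PrimRec_SucE intro: evals_PrimRec_Suc g')
    qed
    have "evals p (PrimRec f' g') xs z" if "evals (S p) (PrimRec f g) xs z" for p xs z
    proof (cases xs)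
      case Nil
      with that show ?thesis by (auto elim: evals.cases)
    next
      case (Cons n xs')
      with that rec show ?thesis by simp
    qed
    then show ?case by blast
  next
    case (Mu f)
    obtain f' where f': "\<And>p xs y. evals (S p) f xs y \<Longrightarrow> evals p f' xs y"
      using Mu.IH by blast
    show ?case by (intro exI[of _ "Mu f'"]) (auto elim!: evals_MuE intro!: evals_Mu f' dest: f' spec)
  qed
  then show ?thesis using e unfolding recfun_def by meson
qed

lemma recpred_oracle:
  assumes "recfun 1 (\<lambda>p xs. S p (xs ! 0))" "recpred k P"
  shows "recpred k (\<lambda>p. P (S p))"
  using recfun_oracle[of S k "\<lambda>p xs. of_bool (P p xs)"] assms unfolding recpred_def by simp

lemma recfun_imp_run:
  assumes "recfun 1 (\<lambda>p xs. F p (xs ! 0))"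
  obtains e where "\<And>p. run e p = Some (F p)"
proof -
  obtain e where e: "\<And>p xs. length xs = 1 \<Longrightarrow> evals p e xs (F p (xs ! 0))"
    using assms unfolding recfun_def by blast
  have "evals p e [n] (F p n)" for p n using e[of "[n]" p] by simp
  then have "run e p = Some (F p)" for p by (simp add: run_eq_Some_iff)
  then show thesis by (rule that)
qed

lemma recfun_imp_computable:
  assumes "recfun 1 (\<lambda>p xs. F p (xs ! 0))"
  shows "computable (\<lambda>p. Some (F p))"
proof -
  obtain e where "\<And>p. run e p = Some (F p)" using assms by (rule recfun_imp_run) blast
  then have "(\<lambda>p. Some (F p)) \<subseteq>\<^sub>m run e" by (simp add: map_le_def)
  then show ?thesis unfolding computable_def by blast
qed

lemma computable_imp_recfun:
  assumes "computable (\<lambda>p. Some (F p))"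
  shows "recfun 1 (\<lambda>p xs. F p (xs ! 0))"
proof -
  obtain e where e: "(\<lambda>p. Some (F p)) \<subseteq>\<^sub>m run e"
    using assms unfolding computable_def by blast
  have "run e p = Some (F p)" for p using e unfolding map_le_def by (metis domI)
  then show ?thesis
    unfolding recfun_def run_eq_Some_iff by (intro exI[of _ e]) (auto simp: length_Suc_conv)
qed

lemma run_minimization:
  assumes "recpred 2 (\<lambda>p xs. P p (xs ! 0) (xs ! 1))" "recfun 2 (\<lambda>p xs. W p (xs ! 0) (xs ! 1))"
  obtains e where "\<And>p. \<forall>n. \<exists>t. P p t n \<Longrightarrow> run e p = Some (\<lambda>n. W p (LEAST t. P p t n) n)"
proof -
  have "recfun 2 (\<lambda>p xs. of_bool (\<not> P p (xs ! 0) (xs ! 1)))"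
    using assms(1) by (rule recfun_of_bool[OF recpred_not])
  then obtain c where c: "\<And>p xs. length xs = 2 \<Longrightarrow> evals p c xs (of_bool (\<not> P p (xs ! 0) (xs ! 1)))"
    unfolding recfun_def by blast
  obtain w where w: "\<And>p xs. length xs = 2 \<Longrightarrow> evals p w xs (W p (xs ! 0) (xs ! 1))"
    using assms(2) unfolding recfun_def by blast
  have "run (Comp w [Mu c, Proj 0]) p = Some (\<lambda>n. W p (LEAST t. P p t n) n)"
    if ex: "\<forall>n. \<exists>t. P p t n" for p
    unfolding run_eq_Some_iff
  proof
    fix n
    let ?t = "LEAST t. P p t n"
    have "evals p (Mu c) [n] ?t"
    proof (rule evals_Mu)
      show "evals p c [?t, n] 0" using c[of "[?t, n]" p] LeastI_ex[OF ex[rule_format, of n]] by simp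
      show "\<forall>m<?t. \<exists>y. evals p c [m, n] (Suc y)"
      proof (intro allI impI)
        fix m assume "m < ?t"
        then have "\<not> P p m n" by (rule not_less_Least)
        then show "\<exists>y. evals p c [m, n] (Suc y)" using c[of "[m, n]" p] by auto
      qed
    qed
    moreover have "evals p (Proj 0) [n] n" using evals_Proj[of 0 "[n]" p] by simp
    moreover have "evals p w [?t, n] (W p ?t n)" using w[of "[?t, n]" p] by simp
    ultimately show "evals p (Comp w [Mu c, Proj 0]) [n] (W p ?t n)"
      by (intro evals_Comp) auto
  qed
  then show thesis by (rule that)
qed


section \<open>Evaluation with bounded search\<close>

text \<open>The value 0 means that the time bound has been exceeded (or the arity is wrong); a value
  \<open>Suc y\<close> means that the result is \<open>y\<close>.\<close>

fun bounded :: "prog \<Rightarrow> baire \<Rightarrow> nat \<Rightarrow> nat list \<Rightarrow> nat" where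
  "bounded Zero p t xs = 1"
| "bounded Succ p t xs = (case xs of [] \<Rightarrow> 0 | x # _ \<Rightarrow> Suc (Suc x))"
| "bounded (Proj i) p t xs = (if i < length xs then Suc (xs ! i) else 0)"
| "bounded Query p t xs = (case xs of [] \<Rightarrow> 0 | x # _ \<Rightarrow> Suc (p x))"
| "bounded (Comp f gs) p t xs =
     (if \<exists>g\<in>set gs. bounded g p t xs = 0 then 0
      else bounded f p t (map (\<lambda>g. bounded g p t xs - 1) gs))"
| "bounded (PrimRec f g) p t xs =
     (case xs of [] \<Rightarrow> 0
      | n # xs \<Rightarrow> rec_nat (bounded f p t xs)
          (\<lambda>i y. if y = 0 then 0 else bounded g p t (i # (y - 1) # xs)) n)"
| "bounded (Mu f) p t xs =
     search (\<lambda>n. bounded f p t (n # xs) = 1 \<and> (\<forall>m<n. 1 < bounded f p t (m # xs))) t"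

lemma bounded_MuD:
  assumes "bounded (Mu f) p t xs = Suc y"
  shows "bounded f p t (y # xs) = Suc 0" "\<forall>m<y. 1 < bounded f p t (m # xs)" "y < t"
proof -
  have s: "search (\<lambda>n. bounded f p t (n # xs) = 1 \<and> (\<forall>m<n. 1 < bounded f p t (m # xs))) t = Suc y"
    using assms unfolding bounded.simps .
  note search_SucD[OF s]
  then show "bounded f p t (y # xs) = Suc 0" "\<forall>m<y. 1 < bounded f p t (m # xs)" "y < t"
    unfolding One_nat_def by blast+
qed

lemma search_least_eqI:
  assumes "f i = Suc 0" "\<forall>m<i. Suc 0 < f m" "i < t"
  shows "search (\<lambda>n. f n = Suc 0 \<and> (\<forall>m<n. Suc 0 < f m)) t = Suc i"
proof (rule search_eqI)
  fix j assume j: "f j = Suc 0 \<and> (\<forall>m<j. Suc 0 < f m)"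
  show "j = i"
  proof (rule linorder_cases)
    assume "j < i"
    with assms(2)[rule_format, of j] j show ?thesis by simp
  next
    assume "i < j"
    with assms(1) j[THEN conjunct2, rule_format, of i] show ?thesis by simp
  qed
qed (use assms in auto)

lemma bounded_mono:
  "bounded e p t xs = Suc y \<Longrightarrow> t \<le> t' \<Longrightarrow> bounded e p t' xs = Suc y"
proof (induction e arbitrary: xs y)
  case (Comp f gs)
  have g: "bounded g p t' xs = bounded g p t xs \<and> bounded g p t xs \<noteq> 0" if "g \<in> set gs" for g
  proof -
    have "bounded g p t xs \<noteq> 0" using Comp.prems(1) that by (auto split: if_splits)
    then obtain z where "bounded g p t xs = Suc z" using not0_implies_Suc by blast
    then show ?thesis using Comp.IH(2)[OF that _ Comp.prems(2)] by simp
  qed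
  then have "map (\<lambda>g. bounded g p t' xs - 1) gs = map (\<lambda>g. bounded g p t xs - 1) gs" by simp
  moreover have "bounded f p t (map (\<lambda>g. bounded g p t xs - 1) gs) = Suc y"
    using Comp.prems(1) by (simp split: if_splits)
  ultimately have "bounded f p t' (map (\<lambda>g. bounded g p t' xs - 1) gs) = Suc y"
    using Comp.IH(1) Comp.prems(2) by (metis (no_types, lifting))
  then show ?case using g by simp
next
  case (PrimRec f g)
  then obtain n xs' where xs: "xs = n # xs'" by (auto split: list.splits)
  let ?r = "\<lambda>t. rec_nat (bounded f p t xs') (\<lambda>i y. if y = 0 then 0 else bounded g p t (i # (y - 1) # xs'))"
  have "?r t' n = Suc y" if "?r t n = Suc y" for n y
    using that
  proof (induction n arbitrary: y)
    case 0
    then show ?case using PrimRec.IH(1) PrimRec.prems(2) by auto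
  next
    case (Suc n)
    have "?r t n \<noteq> 0" using Suc.prems by (intro notI) simp
    then obtain z where z: "?r t n = Suc z" using not0_implies_Suc by blast
    then have "bounded g p t (n # z # xs') = Suc y" using Suc.prems by simp
    then show ?case using Suc.IH[OF z] PrimRec.IH(2) PrimRec.prems(2) by auto
  qed
  with PrimRec.prems xs show ?case by simp
next
  case (Mu f)
  note y = bounded_MuD[OF Mu.prems(1)]
  have "1 < bounded f p t' (m # xs)" if "1 < bounded f p t (m # xs)" for m
    using Mu.IH[of "m # xs" "bounded f p t (m # xs) - 1"] Mu.prems(2) that by auto
  then show ?case
    using y Mu.IH[OF y(1)] Mu.prems(2)
    by (simp add: search_least_eqI[where f = "\<lambda>n. bounded f p t' (n # xs)"])
qed (auto split: list.splits if_splits)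

lemma evals_imp_bounded:
  "evals p e xs y \<Longrightarrow> \<forall>\<^sub>F t in sequentially. bounded e p t xs = Suc y"
proof (induction rule: evals.induct)
  case (evals_Comp xs gs ys f z)
  have "\<forall>i<length gs. \<forall>\<^sub>F t in sequentially. bounded (gs ! i) p t xs = Suc (ys ! i)"
    using evals_Comp.IH(1) by (auto simp: list_all2_conv_all_nth)
  then have "\<forall>\<^sub>F t in sequentially. \<forall>i\<in>{..<length gs}. bounded (gs ! i) p t xs = Suc (ys ! i)"
    by (intro eventually_ball_finite) auto
  with evals_Comp.IH(2) show ?case
  proof eventually_elim
    case (elim t)
    have "map (\<lambda>g. bounded g p t xs - 1) gs = ys"
      using elim(2) evals_Comp.IH(1) by (auto simp: list_all2_conv_all_nth intro!: nth_equalityI)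
    moreover have "\<not> (\<exists>g\<in>set gs. bounded g p t xs = 0)"
      using elim(2) by (auto simp: in_set_conv_nth)
    ultimately show ?case using elim(1) by simp
  qed
next
  case (evals_PrimRec_Suc f g n xs y z)
  from evals_PrimRec_Suc.IH show ?case by eventually_elim simp
next
  case (evals_Mu f n xs)
  have "\<forall>m<n. \<forall>\<^sub>F t in sequentially. 1 < bounded f p t (m # xs)"
  proof (intro allI impI)
    fix m assume "m < n"
    then obtain y where "\<forall>\<^sub>F t in sequentially. bounded f p t (m # xs) = Suc (Suc y)"
      using evals_Mu.IH(2) by blast
    then show "\<forall>\<^sub>F t in sequentially. 1 < bounded f p t (m # xs)" by eventually_elim simp
  qed
  then have "\<forall>\<^sub>F t in sequentially. \<forall>m\<in>{..<n}. 1 < bounded f p t (m # xs)"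
    by (intro eventually_ball_finite) auto
  with evals_Mu.IH(1) eventually_gt_at_top[of n] show ?case
  proof eventually_elim
    case (elim t)
    then show ?case by (auto simp: search_least_eqI[where f = "\<lambda>n. bounded f p t (n # xs)"])
  qed
qed auto

lemma recfun_bounded:
  assumes "recfun k t" "\<And>v. v \<in> set vs \<Longrightarrow> recfun k v"
  shows "recfun k (\<lambda>p xs. bounded e p (t p xs) (map (\<lambda>v. v p xs) vs))"
  using assms
proof (induction e arbitrary: k t vs)
  case Zero
  then show ?case by (simp add: recfun_const)
next
  case Succ
  then show ?case by (cases vs) (auto intro!: rec_intros)
next
  case (Proj i)
  then show ?case by (cases "i < length vs") (auto intro!: rec_intros)
next
  case Query
  then show ?case by (cases vs) (auto intro!: rec_intros)
next
  case (Comp f gs)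
  have ex: "recpred k (\<lambda>p xs. \<exists>g\<in>set hs. bounded g p (t p xs) (map (\<lambda>v. v p xs) vs) = 0)"
    if "set hs \<subseteq> set gs" for hs
    using that
  proof (induction hs)
    case Nil
    show ?case by (simp add: recpred_const)
  next
    case (Cons h hs)
    then show ?case using Comp.IH(2)[of h k t vs] Comp.prems by (auto intro!: rec_intros)
  qed
  let ?hs = "map (\<lambda>g p xs. bounded g p (t p xs) (map (\<lambda>v. v p xs) vs) - 1) gs"
  have "recfun k (\<lambda>p xs. bounded f p (t p xs) (map (\<lambda>v. v p xs) ?hs))"
    using Comp by (intro Comp.IH(1)) (auto intro!: rec_intros)
  then show ?case using ex[of gs] by (auto simp: comp_def intro!: rec_intros)
next
  case (PrimRec f g)
  show ?case
  proof (cases vs)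
    case Nil
    then show ?thesis by (simp add: recfun_const)
  next
    case (Cons n vs')
    let ?t = "\<lambda>p ys. t p (tl (tl ys))"
    let ?vs = "(\<lambda>p ys. hd ys) # (\<lambda>p ys. hd (tl ys) - 1) # map (\<lambda>v p ys. v p (tl (tl ys))) vs'"
    have "recfun (Suc (Suc k)) (\<lambda>p ys. bounded g p (?t p ys) (map (\<lambda>v. v p ys) ?vs))"
      using PrimRec.prems Cons by (intro PrimRec.IH(2)) (auto intro!: rec_intros recfun_tl)
    moreover have "recfun k (\<lambda>p xs. bounded f p (t p xs) (map (\<lambda>v. v p xs) vs'))"
      using PrimRec.prems Cons by (intro PrimRec.IH(1)) auto
    ultimately show ?thesis using PrimRec.prems Cons
      by (auto simp: comp_def intro!: rec_intros)
  qed
next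
  case (Mu f)
  have "recfun (Suc k) (\<lambda>p ys. bounded f p (t p (tl ys))
      (map (\<lambda>v. v p ys) ((\<lambda>p ys. hd ys) # map (\<lambda>v p ys. v p (tl ys)) vs)))"
    using Mu.prems by (intro Mu.IH) (auto intro!: rec_intros recfun_tl)
  moreover have "recfun (Suc (Suc k)) (\<lambda>p ys. bounded f p (t p (tl (tl ys)))
      (map (\<lambda>v. v p ys) ((\<lambda>p ys. hd ys) # map (\<lambda>v p ys. v p (tl (tl ys))) vs)))"
    using Mu.prems by (intro Mu.IH) (auto intro!: rec_intros recfun_tl)
  ultimately show ?case using Mu.prems by (auto simp: comp_def intro!: rec_intros)
qed


section \<open>Rational arithmetic on codes\<close>

lemma recfun_half [rec_intros]: "recfun k f \<Longrightarrow> recfun k (\<lambda>p xs. f p xs div 2)"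
proof (rule recfun_comp1[where f = "\<lambda>p n. n div 2"])
  have "n div 2 = search (\<lambda>i. n = 2 * i \<or> n = Suc (2 * i)) (Suc n) - 1" for n
    by (subst search_eqI[where i = "n div 2"]) auto
  then show "recfun 1 (\<lambda>p xs. xs ! 0 div 2)" by (simp only:) (intro rec_intros; simp)
qed

lemma recpred_even [rec_intros]: "recfun k f \<Longrightarrow> recpred k (\<lambda>p xs. even (f p xs))"
proof -
  assume "recfun k f"
  then have "recpred k (\<lambda>p xs. f p xs = 2 * (f p xs div 2))" by (intro rec_intros)
  moreover have "even n \<longleftrightarrow> n = 2 * (n div 2)" for n :: nat by presburger
  ultimately show ?thesis by (simp only:)
qed

lemma recfun_prod_encode [rec_intros]:
  "recfun k f \<Longrightarrow> recfun k g \<Longrightarrow> recfun k (\<lambda>p xs. prod_encode (f p xs, g p xs))"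
  unfolding prod_encode_def triangle_def case_prod_conv by (intro rec_intros)

lemma recfun_fst_prod_decode [rec_intros]:
  "recfun k f \<Longrightarrow> recfun k (\<lambda>p xs. fst (prod_decode (f p xs)))"
proof (rule recfun_comp1[where f = "\<lambda>p n. fst (prod_decode n)"])
  have "fst (prod_decode n) = search (\<lambda>i. \<exists>j<Suc n. prod_encode (i, j) = n) (Suc n) - 1" for n
  proof -
    obtain i j where n: "prod_decode n = (i, j)" by force
    then have "n = prod_encode (i, j)" by (metis prod_decode_inverse)
    then have "search (\<lambda>i. \<exists>j<Suc n. prod_encode (i, j) = n) (Suc n) = Suc i"
      using le_prod_encode_1[of i j] le_prod_encode_2[of j i] by (intro search_eqI) auto
    with n show ?thesis by simp
  qed
  then show "recfun 1 (\<lambda>p xs. fst (prod_decode (xs ! 0)))" by (simp only:) (intro rec_intros; simp)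
qed

lemma recfun_snd_prod_decode [rec_intros]:
  "recfun k f \<Longrightarrow> recfun k (\<lambda>p xs. snd (prod_decode (f p xs)))"
proof (rule recfun_comp1[where f = "\<lambda>p n. snd (prod_decode n)"])
  have "snd (prod_decode n) = search (\<lambda>j. prod_encode (fst (prod_decode n), j) = n) (Suc n) - 1" for n
  proof -
    obtain i j where n: "prod_decode n = (i, j)" by force
    then have "n = prod_encode (i, j)" by (metis prod_decode_inverse)
    then have "search (\<lambda>j. prod_encode (i, j) = n) (Suc n) = Suc j"
      using le_prod_encode_2[of j i] by (intro search_eqI) auto
    with n show ?thesis by simp
  qed
  then show "recfun 1 (\<lambda>p xs. snd (prod_decode (xs ! 0)))" by (simp only:) (intro rec_intros; simp)
qed

definition rat_val :: "nat \<Rightarrow> real" where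
  "rat_val n = real_of_rat (nat_to_rat_surj n)"

definition rat_sgn :: "nat \<Rightarrow> bool" where
  "rat_sgn n = even (fst (prod_decode n) + snd (prod_decode n))"

definition rat_num :: "nat \<Rightarrow> nat" where
  "rat_num n = (if snd (prod_decode n) = 0 then 0 else Suc (fst (prod_decode n)) div 2)"

definition rat_den :: "nat \<Rightarrow> nat" where
  "rat_den n = (if snd (prod_decode n) = 0 then 1 else Suc (snd (prod_decode n)) div 2)"

lemma int_decode_eq: "int_decode n = (if even n then 1 else - 1) * int (Suc n div 2)"
  by (auto simp: int_decode_def sum_decode_def elim!: oddE)

lemma rat_den_pos: "rat_den n > 0"
  by (auto simp: rat_den_def)

lemma rat_val_eq: "rat_val n = (if rat_sgn n then 1 else - 1) * rat_num n / rat_den n"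
proof -
  obtain a b where ab: "prod_decode n = (a, b)" by force
  have "real_of_rat (Fract x y) = of_int x / of_int y" for x y
    by (cases "y = 0") (auto simp: of_rat_rat rat_number_collapse)
  then have "rat_val n = of_int (int_decode a) / of_int (int_decode b)"
    by (simp add: rat_val_def nat_to_rat_surj_def ab)
  also have "\<dots> = (if even a then 1 else - 1) * (if even b then 1 else - 1) *
      real (Suc a div 2) / real (Suc b div 2)"
  proof -
    have "real_of_int (int_decode n) = (if even n then 1 else - 1) * real (Suc n div 2)" for n
      by (simp add: int_decode_eq)
    moreover have "s * x / ((if Q then 1 else - 1) * y) = s * (if Q then 1 else - 1) * x / y"
      for s x y :: real and Q by simp
    ultimately show ?thesis by (simp only:)
  qed
  finally show ?thesis
    by (cases "even a"; cases "even b"; cases "b = 0")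
      (simp_all only: rat_sgn_def rat_num_def rat_den_def ab, simp_all)
qed

lemma recpred_rat_le [rec_intros]:
  assumes "recfun k a" "recfun k b" "recfun k c" "recfun k d"
  shows "recpred k (\<lambda>p xs. rat_val (a p xs) \<le> rat_val (b p xs) + real (d p xs) / 2 ^ c p xs)"
proof (rule recpred_comp4[OF _ assms, where f = "\<lambda>p a b c d. rat_val a \<le> rat_val b + real d / 2 ^ c"])
  define pos where "pos n = (if rat_sgn n then rat_num n else 0)" for n
  define neg where "neg n = (if rat_sgn n then 0 else rat_num n)" for n
  have "rat_val a \<le> rat_val b + real d / 2 ^ c \<longleftrightarrow>
      (pos a * rat_den b + neg b * rat_den a) * 2 ^ c \<le>
      (pos b * rat_den a + neg a * rat_den b) * 2 ^ c + d * rat_den a * rat_den b" for a b c d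
  proof -
    have v: "rat_val n = (real (pos n) - real (neg n)) / rat_den n" for n
      by (simp add: rat_val_eq pos_def neg_def)
    define P where "P = real (rat_den a) * real (rat_den b) * 2 ^ c"
    have P: "P > 0" using rat_den_pos[of a] rat_den_pos[of b] by (simp add: P_def)
    have "rat_val a \<le> rat_val b + real d / 2 ^ c \<longleftrightarrow>
        rat_val a * P \<le> (rat_val b + real d / 2 ^ c) * P"
      using P by simp
    also have "rat_val a * P = (real (pos a) - real (neg a)) * real (rat_den b) * 2 ^ c"
      using rat_den_pos[of a] by (simp add: P_def v)
    also have "(rat_val b + real d / 2 ^ c) * P =
        (real (pos b) - real (neg b)) * real (rat_den a) * 2 ^ c + real d * rat_den a * rat_den b"
      using rat_den_pos[of b] by (simp add: P_def v field_simps)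
    also have "(real (pos a) - real (neg a)) * real (rat_den b) * 2 ^ c
        \<le> (real (pos b) - real (neg b)) * real (rat_den a) * 2 ^ c + real d * rat_den a * rat_den b \<longleftrightarrow>
      real ((pos a * rat_den b + neg b * rat_den a) * 2 ^ c) \<le>
      real ((pos b * rat_den a + neg a * rat_den b) * 2 ^ c + d * rat_den a * rat_den b)"
      by (simp add: algebra_simps)
    finally show ?thesis unfolding of_nat_le_iff .
  qed
  then show "recpred 4 (\<lambda>p xs. rat_val (xs ! 0) \<le> rat_val (xs ! 1) + real (xs ! 3) / 2 ^ (xs ! 2))"
    by (simp only: pos_def neg_def rat_sgn_def rat_num_def rat_den_def) (intro rec_intros; simp)
qed

lemma recpred_rat_le_rat [rec_intros]:
  assumes "recfun k a" "recfun k b"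
  shows "recpred k (\<lambda>p xs. rat_val (a p xs) \<le> rat_val (b p xs))"
  using recpred_rat_le[OF assms recfun_const[of k 0] recfun_const[of k 0]] by simp

lemma recpred_rat_close [rec_intros]:
  assumes "recfun k a" "recfun k b" "recfun k c"
  shows "recpred k (\<lambda>p xs. \<bar>rat_val (a p xs) - rat_val (b p xs)\<bar> \<le> 1 / 2 ^ c p xs)"
proof -
  have "\<bar>rat_val a - rat_val b\<bar> \<le> 1 / 2 ^ c \<longleftrightarrow>
      rat_val a \<le> rat_val b + real 1 / 2 ^ c \<and> rat_val b \<le> rat_val a + real 1 / 2 ^ c" for a b c
    by (auto simp: abs_le_iff)
  then show ?thesis using assms by (simp only:) (intro rec_intros)
qed

definition one_code :: nat where
  "one_code = prod_encode (int_encode 1, int_encode 1)"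

definition clip :: "nat \<Rightarrow> nat" where
  "clip c = (if rat_val c \<le> rat_val 0 then 0 else if rat_val one_code \<le> rat_val c then one_code else c)"

lemma rat_val_0 [simp]: "rat_val 0 = 0"
  by (simp add: rat_val_def nat_to_rat_surj_def prod_decode_def prod_decode_aux.simps
      int_decode_def sum_decode_def rat_number_collapse)

lemma rat_val_one_code [simp]: "rat_val one_code = 1"
  by (simp add: rat_val_def one_code_def nat_to_rat_surj_def rat_number_collapse)

lemma rat_val_clip: "rat_val (clip c) = max 0 (min 1 (rat_val c))"
  by (simp add: clip_def)

lemma recfun_clip [rec_intros]: "recfun k f \<Longrightarrow> recfun k (\<lambda>p xs. clip (f p xs))"
  unfolding clip_def by (intro rec_intros)


section \<open>Cauchy names\<close>

lemma cauchy_name_iff: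
  "cauchy_name p x \<longleftrightarrow>
     (\<forall>i j. i < j \<longrightarrow> \<bar>rat_val (p i) - rat_val (p j)\<bar> \<le> 1 / 2 ^ i) \<and> (\<lambda>n. rat_val (p n)) \<longlonglongrightarrow> x"
  by (simp add: cauchy_name_def rat_val_def Let_def)

lemma cauchy_name_dist:
  assumes "cauchy_name p x"
  shows "\<bar>rat_val (p m) - x\<bar> \<le> 1 / 2 ^ m"
proof (rule tendsto_upperbound)
  show "(\<lambda>j. \<bar>rat_val (p m) - rat_val (p j)\<bar>) \<longlonglongrightarrow> \<bar>rat_val (p m) - x\<bar>"
    using assms by (intro tendsto_intros) (simp add: cauchy_name_iff)
  show "\<forall>\<^sub>F j in sequentially. \<bar>rat_val (p m) - rat_val (p j)\<bar> \<le> 1 / 2 ^ m"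
    using eventually_gt_at_top[of m] by eventually_elim (use assms in \<open>simp add: cauchy_name_iff\<close>)
qed simp

lemma ex_unit_rep:
  assumes "\<And>i j. i < j \<Longrightarrow> \<bar>rat_val (p i) - rat_val (p j)\<bar> \<le> 1 / 2 ^ i"
    and "\<And>n. rat_val (p n) \<in> {0..1}"
  shows "\<exists>z. unit_rep p = Some z"
proof -
  have "Cauchy (\<lambda>n. rat_val (p n))"
  proof (rule metric_CauchyI)
    fix e :: real assume "e > 0"
    then obtain M where M: "1 / 2 ^ M < e / 2"
      using real_arch_pow_inv[of "e / 2" "1 / 2"] by (auto simp: power_divide)
    have *: "\<bar>rat_val (p M) - rat_val (p n)\<bar> \<le> 1 / 2 ^ M" if "n \<ge> M" for n
      using assms(1)[of M n] that by (cases "n = M") auto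
    then have "dist (rat_val (p m)) (rat_val (p n)) < e" if "m \<ge> M" "n \<ge> M" for m n
      using M * [OF that(1)] * [OF that(2)] unfolding dist_real_def by linarith
    then show "\<exists>M. \<forall>m\<ge>M. \<forall>n\<ge>M. dist (rat_val (p m)) (rat_val (p n)) < e" by blast
  qed
  then obtain z where z: "(\<lambda>n. rat_val (p n)) \<longlonglongrightarrow> z"
    using Cauchy_convergent_iff convergent_def by blast
  have "z \<in> {0..1}"
    using LIMSEQ_le_const[OF z, of 0] LIMSEQ_le_const2[OF z, of 1] assms(2) by auto
  then show ?thesis using assms(1) z by (auto simp: unit_rep_eq_Some_iff cauchy_name_iff)
qed

lemma clip_cong_dist: "\<bar>max 0 (min 1 x) - max 0 (min 1 y)\<bar> \<le> \<bar>x - y :: real\<bar>"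
  by (auto simp: max_def min_def)

lemma unit_rep_clip:
  assumes "unit_rep p = Some x"
  shows "unit_rep (\<lambda>n. clip (p n)) = Some x"
proof -
  have x: "x \<in> {0..1}" "cauchy_name p x" using assms by (auto simp: unit_rep_eq_Some_iff)
  have "(\<lambda>n. max 0 (min 1 (rat_val (p n)))) \<longlonglongrightarrow> max 0 (min 1 x)"
    using x(2) by (intro tendsto_intros) (simp add: cauchy_name_iff)
  moreover have "max 0 (min 1 x) = x" using x(1) by auto
  moreover have "\<bar>max 0 (min 1 (rat_val (p i))) - max 0 (min 1 (rat_val (p j)))\<bar> \<le> 1 / 2 ^ i" if "i < j" for i j
    using x(2) that unfolding cauchy_name_iff by (blast intro: order_trans[OF clip_cong_dist])
  ultimately show ?thesis
    using x(1) by (simp add: unit_rep_eq_Some_iff cauchy_name_iff rat_val_clip)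
qed


section \<open>From the implication to half choice\<close>

definition in_oracle :: "nat \<Rightarrow> baire \<Rightarrow> baire" where
  "in_oracle b r = pair (fst_part r) (\<lambda>_. b)"

definition stage :: "prog \<Rightarrow> nat \<Rightarrow> baire \<Rightarrow> nat \<Rightarrow> nat \<Rightarrow> nat" where
  "stage u b r t n = bounded u (in_oracle b r) t [n]"

definition removed :: "nat \<Rightarrow> baire \<Rightarrow> nat \<Rightarrow> bool" where
  "removed b r t \<longleftrightarrow> (\<exists>m<t. snd_part r m = Suc b)"

definition good :: "(nat \<Rightarrow> nat \<Rightarrow> nat) \<Rightarrow> nat \<Rightarrow> nat \<Rightarrow> bool" where
  "good f t n \<longleftrightarrow> (\<forall>j<Suc n. f t j \<noteq> 0) \<and>
     (\<forall>j<Suc n. \<forall>i<j. \<bar>rat_val (clip (f t i - 1)) - rat_val (clip (f t j - 1))\<bar> \<le> 1 / 2 ^ i)"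

text \<open>\<open>f t n\<close> is 0 or the successor of the \<open>n\<close>-th output found within \<open>t\<close> steps; \<open>frozen\<close> repeats the last
  value before the output of \<open>f t\<close> stops or ceases to be a Cauchy name.\<close>

definition frozen :: "(nat \<Rightarrow> nat \<Rightarrow> nat) \<Rightarrow> nat \<Rightarrow> nat \<Rightarrow> nat" where
  "frozen f t n =
     rec_nat (if good f t 0 then clip (f t 0 - 1) else 0)
       (\<lambda>m y. if good f t (Suc m) then clip (f t (Suc m) - 1) else y) n"

definition ready :: "(nat \<Rightarrow> nat \<Rightarrow> nat) \<Rightarrow> (nat \<Rightarrow> bool) \<Rightarrow> nat \<Rightarrow> nat \<Rightarrow> bool" where
  "ready f R t n \<longleftrightarrow> good f t n \<or> R t"

definition guarded :: "(nat \<Rightarrow> nat \<Rightarrow> nat) \<Rightarrow> (nat \<Rightarrow> bool) \<Rightarrow> baire" where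
  "guarded f R n = frozen f (LEAST t. ready f R t n) n"

lemma frozen_0: "frozen f t 0 = (if good f t 0 then clip (f t 0 - 1) else 0)"
  by (simp add: frozen_def)

lemma frozen_Suc:
  "frozen f t (Suc m) = (if good f t (Suc m) then clip (f t (Suc m) - 1) else frozen f t m)"
  by (simp add: frozen_def)

lemma good_antimono: "good f t n \<Longrightarrow> m \<le> n \<Longrightarrow> good f t m"
  unfolding good_def by (meson Suc_le_mono less_le_trans)

lemma frozen_good: "good f t n \<Longrightarrow> frozen f t n = clip (f t n - 1)"
  by (cases n) (simp_all add: frozen_0 frozen_Suc)

lemma frozen_unit: "rat_val (frozen f t n) \<in> {0..1}"
  by (induction n) (auto simp: frozen_0 frozen_Suc rat_val_clip)

lemma frozen_dist: "i < j \<Longrightarrow> \<bar>rat_val (frozen f t i) - rat_val (frozen f t j)\<bar> \<le> 1 / 2 ^ i"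
proof (induction j)
  case (Suc j)
  show ?case
  proof (cases "good f t (Suc j)")
    case True
    then have "frozen f t i = clip (f t i - 1)" "frozen f t (Suc j) = clip (f t (Suc j) - 1)"
      using Suc.prems good_antimono[OF True, of i] by (simp_all add: frozen_good)
    then show ?thesis using True Suc.prems by (simp add: good_def)
  next
    case False
    then have "frozen f t (Suc j) = frozen f t j" by (simp add: frozen_Suc)
    then show ?thesis using Suc by (cases "i = j") auto
  qed
qed simp

context
  fixes f :: "nat \<Rightarrow> nat \<Rightarrow> nat" and R :: "nat \<Rightarrow> bool"
  assumes f_mono: "\<And>t t' n. f t n \<noteq> 0 \<Longrightarrow> t \<le> t' \<Longrightarrow> f t' n = f t n"
begin

lemma good_persists:
  assumes "good f t n" "t \<le> t'"
  shows "good f t' n" "frozen f t' n = frozen f t n"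
proof -
  have f: "f t' j = f t j" if "j < Suc n" for j
    using assms that f_mono unfolding good_def by blast
  then show g: "good f t' n" using assms(1) unfolding good_def by simp
  show "frozen f t' n = frozen f t n"
    using f[of n] by (simp add: frozen_good assms(1) g)
qed

lemma ex_unit_rep_guarded:
  assumes ready: "\<And>n. \<exists>t. ready f R t n"
  shows "\<exists>z. unit_rep (guarded f R) = Some z"
proof (rule ex_unit_rep)
  fix i j :: nat assume ij: "i < j"
  let ?t = "\<lambda>n. LEAST t. ready f R t n"
  have r: "ready f R (?t n) n" for n using ready by (rule LeastI_ex)
  have "ready f R (?t j) i"
    using r[of j] ij good_antimono[of f "?t j" j i] unfolding ready_def by auto
  then have le: "?t i \<le> ?t j" by (rule Least_le)
  have "frozen f (?t i) i = frozen f (?t j) i"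
  proof (cases "good f (?t i) i")
    case True
    then show ?thesis using good_persists(2)[OF True le] by simp
  next
    case False
    then have "ready f R (?t i) j" using r[of i] unfolding ready_def by blast
    then have "?t j \<le> ?t i" by (rule Least_le)
    with le show ?thesis by simp
  qed
  then show "\<bar>rat_val (guarded f R i) - rat_val (guarded f R j)\<bar> \<le> 1 / 2 ^ i"
    using frozen_dist[OF ij, of f "?t j"] by (simp add: guarded_def)
qed (simp add: guarded_def frozen_unit del: atLeastAtMost_iff)

lemma unit_rep_guarded:
  assumes f: "\<And>n. \<forall>\<^sub>F t in sequentially. f t n = Suc (s n)"
    and s: "unit_rep s = Some z" and R: "\<And>t. \<not> R t"
  shows "\<exists>t. ready f R t n" and "unit_rep (guarded f R) = Some z"
proof -
  have z: "unit_rep (\<lambda>n. clip (s n)) = Some z" using s by (rule unit_rep_clip)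
  have "\<exists>t. good f t n" for n
  proof -
    have "\<forall>\<^sub>F t in sequentially. \<forall>j\<in>{..n}. f t j = Suc (s j)"
      using f by (intro eventually_ball_finite) auto
    then obtain t where t: "\<And>j. j < Suc n \<Longrightarrow> f t j = Suc (s j)"
      using eventually_happens[of _ sequentially] by fastforce
    have "\<bar>rat_val (clip (s i)) - rat_val (clip (s j))\<bar> \<le> 1 / 2 ^ i" if "i < j" for i j
      using z that by (simp add: unit_rep_eq_Some_iff cauchy_name_iff)
    then have "good f t n" unfolding good_def using t by simp
    then show ?thesis by blast
  qed
  then show r: "\<exists>t. ready f R t n" for n unfolding ready_def by blast
  have "guarded f R n = clip (s n)" for n
  proof -
    define t where "t = (LEAST t. ready f R t n)"
    have g: "good f t n"
      using LeastI_ex[OF r[of n]] R unfolding t_def ready_def by blast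
    obtain t' where t': "t \<le> t'" "f t' n = Suc (s n)"
      using f[of n] unfolding eventually_sequentially by (meson nat_le_linear order_refl)
    have "f t n = Suc (s n)" using f_mono[OF _ t'(1), of n] t'(2) g unfolding good_def by simp
    then show ?thesis by (simp add: guarded_def frozen_good[OF g] flip: t_def)
  qed
  then have "guarded f R = (\<lambda>n. clip (s n))" by (rule ext)
  with z show "unit_rep (guarded f R) = Some z" by simp
qed

end

lemma stage_mono: "stage u b r t n \<noteq> 0 \<Longrightarrow> t \<le> t' \<Longrightarrow> stage u b r t' n = stage u b r t n"
  using bounded_mono[of u "in_oracle b r" t "[n]" "stage u b r t n - 1" t'] by (simp add: stage_def)

lemma stage_run:
  assumes "run u (in_oracle b r) = Some s"
  shows "\<forall>\<^sub>F t in sequentially. stage u b r t n = Suc (s n)"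
  using assms unfolding stage_def run_eq_Some_iff by (blast intro: evals_imp_bounded)

lemma recfun_stage [rec_intros]:
  "recfun k t \<Longrightarrow> recfun k n \<Longrightarrow> recfun k (\<lambda>r xs. stage u b r (t r xs) (n r xs))"
proof (rule recfun_comp2[where f = "\<lambda>r t n. stage u b r t n"])
  have "recfun 2 (\<lambda>p xs. bounded u p (xs ! 0) (map (\<lambda>v. v p xs) [\<lambda>p xs. xs ! 1]))"
    by (rule recfun_bounded) (auto intro: recfun_nth)
  then have F: "recfun 2 (\<lambda>p xs. bounded u p (xs ! 0) [xs ! 1])" by simp
  have "in_oracle b r n = (if even n then r n else b)" for r n
    by (simp add: in_oracle_def pair_def fst_part_def)
  then have "recfun 1 (\<lambda>r xs. in_oracle b r (xs ! 0))" by (simp only:) (intro rec_intros; simp)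
  then show "recfun 2 (\<lambda>r xs. stage u b r (xs ! 0) (xs ! 1))"
    unfolding stage_def using F by (rule recfun_oracle)
qed

lemma recpred_removed [rec_intros]:
  "recfun k t \<Longrightarrow> recpred k (\<lambda>r xs. removed b r (t r xs))"
  unfolding removed_def snd_part_def by (intro rec_intros)

lemma recpred_good [rec_intros]:
  "recfun k t \<Longrightarrow> recfun k n \<Longrightarrow> recpred k (\<lambda>r xs. good (stage u b r) (t r xs) (n r xs))"
proof (rule recpred_comp2[where f = "\<lambda>r t n. good (stage u b r) t n"])
  show "recpred 2 (\<lambda>r xs. good (stage u b r) (xs ! 0) (xs ! 1))"
    unfolding good_def by (intro rec_intros; simp)
qed

lemma recfun_frozen [rec_intros]:
  "recfun k t \<Longrightarrow> recfun k n \<Longrightarrow> recfun k (\<lambda>r xs. frozen (stage u b r) (t r xs) (n r xs))"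
proof (rule recfun_comp2[where f = "\<lambda>r t n. frozen (stage u b r) t n"])
  show "recfun 2 (\<lambda>r xs. frozen (stage u b r) (xs ! 0) (xs ! 1))"
    unfolding frozen_def by (intro rec_intros; simp)
qed

definition solve :: "prog \<Rightarrow> nat \<Rightarrow> baire \<Rightarrow> baire" where
  "solve u b r = guarded (stage u b r) (removed b r)"

lemma run_solve:
  obtains e where
    "\<And>p r. (\<And>n. \<exists>t. ready (stage u 0 r) (removed 0 r) t n) \<Longrightarrow>
       (\<And>n. \<exists>t. ready (stage u 1 r) (removed 1 r) t n) \<Longrightarrow>
       run e (pair p r) = Some (pair (solve u 0 r) (solve u 1 r))"
proof -
  let ?ready = "\<lambda>b r t n. ready (stage u b r) (removed b r) t (n div 2)"
  let ?frozen = "\<lambda>b r t n. frozen (stage u b r) t (n div 2)"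
  let ?P = "\<lambda>r t n. if even n then ?ready 0 r t n else ?ready 1 r t n"
  let ?W = "\<lambda>r t n. if even n then ?frozen 0 r t n else ?frozen 1 r t n"
  have snd: "recfun 1 (\<lambda>p xs. snd_part p (xs ! 0))"
    unfolding snd_part_def by (intro rec_intros; simp)
  have "recpred 2 (\<lambda>r xs. ?P r (xs ! 0) (xs ! 1))"
    unfolding ready_def by (intro rec_intros; simp)
  then have P: "recpred 2 (\<lambda>p xs. ?P (snd_part p) (xs ! 0) (xs ! 1))"
    by (rule recpred_oracle[OF snd])
  have "recfun 2 (\<lambda>r xs. ?W r (xs ! 0) (xs ! 1))"
    by (intro rec_intros; simp)
  then have W: "recfun 2 (\<lambda>p xs. ?W (snd_part p) (xs ! 0) (xs ! 1))"
    by (rule recfun_oracle[OF snd])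
  obtain e where e: "\<And>p. \<forall>n. \<exists>t. ?P (snd_part p) t n \<Longrightarrow>
      run e p = Some (\<lambda>n. ?W (snd_part p) (LEAST t. ?P (snd_part p) t n) n)"
    using run_minimization[OF P W] by blast
  show thesis
  proof (rule that)
    fix p r
    assume r: "\<And>n. \<exists>t. ready (stage u 0 r) (removed 0 r) t n"
      "\<And>n. \<exists>t. ready (stage u 1 r) (removed 1 r) t n"
    have "\<exists>t. ?P r t n" for n using r[of "n div 2"] by (cases "even n") simp_all
    then have "\<forall>n. \<exists>t. ?P (snd_part (pair p r)) t n" unfolding pair_parts by blast
    from e[OF this] show "run e (pair p r) = Some (pair (solve u 0 r) (solve u 1 r))"
      by (auto simp: pair_def solve_def guarded_def fun_eq_iff)
  qed
qed


section \<open>From half choice to the implication\<close>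

lemma rat_interval_eq:
  "rat_interval n = {rat_val (fst (prod_decode n))<..<rat_val (snd (prod_decode n))}"
  by (simp add: rat_interval_def rat_val_def split: prod.split)

text \<open>Entry \<open>\<langle>j, 2 m + b\<rangle>\<close> tests whether the \<open>m\<close>-th approximation places the point named by component \<open>b\<close>
  of \<open>r\<close> in the interval listed at position \<open>j\<close> of \<open>p\<close>.\<close>

definition excluded :: "baire \<Rightarrow> baire \<Rightarrow> baire" where
  "excluded p r n =
     (let j = fst (prod_decode n); l = snd (prod_decode n); k = p j - 1; m = l div 2
      in if p j \<noteq> 0 \<and> \<not> rat_val (r l) \<le> rat_val (fst (prod_decode k)) + real 1 / 2 ^ m \<and>
            \<not> rat_val (snd (prod_decode k)) \<le> rat_val (r l) + real 1 / 2 ^ m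
         then Suc (if even l then 0 else 1) else 0)"

lemma enumerated_excluded:
  assumes x: "unit_rep (fst_part r) = Some (x 0)" "unit_rep (snd_part r) = Some (x (Suc 0))"
  shows "enumerated (excluded p r) = {b \<in> {0, 1}. x b \<in> (\<Union>k\<in>enumerated p. rat_interval k)}"
    (is "_ = ?B")
proof (intro equalityI subsetI)
  have dist: "\<bar>rat_val (r l) - x (if even l then 0 else 1)\<bar> \<le> 1 / 2 ^ (l div 2)" for l
  proof (cases "even l")
    case True
    then have "fst_part r (l div 2) = r l" by (simp add: fst_part_def)
    then show ?thesis using True x(1) cauchy_name_dist[of "fst_part r" "x 0" "l div 2"]
      by (simp add: unit_rep_eq_Some_iff)
  next
    case False
    then have "snd_part r (l div 2) = r l" by (simp add: snd_part_def)
    then show ?thesis using False x(2) cauchy_name_dist[of "snd_part r" "x 1" "l div 2"]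
      by (simp add: unit_rep_eq_Some_iff)
  qed
  {
    fix b assume "b \<in> enumerated (excluded p r)"
    then obtain n where n: "excluded p r n = Suc b" unfolding enumerated_def by (auto simp del: One_nat_def)
    define j l k where "j = fst (prod_decode n)" and "l = snd (prod_decode n)" and "k = p j - 1"
    have k: "p j = Suc k"
      and b: "b = (if even l then 0 else 1)"
      and lo: "rat_val (fst (prod_decode k)) + 1 / 2 ^ (l div 2) < rat_val (r l)"
      and hi: "rat_val (r l) + 1 / 2 ^ (l div 2) < rat_val (snd (prod_decode k))"
      using n by (auto simp: excluded_def Let_def j_def l_def k_def split: if_splits)
    have "k \<in> enumerated p" using k by (auto simp: enumerated_def intro: range_eqI[of _ _ j])
    moreover have "x b \<in> rat_interval k"
      using dist[of l] lo hi unfolding rat_interval_eq b[symmetric] by auto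
    ultimately show "b \<in> ?B" using b by auto
  next
    fix b assume "b \<in> ?B"
    then obtain k where b: "b \<in> {0, 1}" and k: "k \<in> enumerated p" "x b \<in> rat_interval k" by blast
    obtain j where j: "p j = Suc k" using k(1) unfolding enumerated_def by (auto simp del: One_nat_def)
    define d where
      "d = min (x b - rat_val (fst (prod_decode k))) (rat_val (snd (prod_decode k)) - x b)"
    have "d > 0" using k(2) by (simp add: d_def rat_interval_eq)
    then obtain m where m: "1 / 2 ^ m < d / 2"
      using real_arch_pow_inv[of "d / 2" "1 / 2"] by (auto simp: power_divide)
    define l where "l = 2 * m + b"
    have l: "l div 2 = m" "(if even l then 0 else 1) = b" using b by (auto simp: l_def)
    have "\<bar>rat_val (r l) - x b\<bar> \<le> 1 / 2 ^ m" using dist[of l] unfolding l .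
    then have "rat_val (fst (prod_decode k)) + 1 / 2 ^ m < rat_val (r l)"
      "rat_val (r l) + 1 / 2 ^ m < rat_val (snd (prod_decode k))"
      using m by (auto simp: d_def abs_le_iff)
    then have "excluded p r (prod_encode (j, l)) = Suc b"
      using j l by (simp add: excluded_def)
    then show "b \<in> enumerated (excluded p r)"
      by (auto simp: enumerated_def intro: range_eqI[of _ _ "prod_encode (j, l)"])
  }
qed

lemma recfun_excluded:
  "recfun 1 (\<lambda>q xs. excluded (fst_part q) (snd_part q) (xs ! 0))"
  unfolding excluded_def Let_def fst_part_def snd_part_def by (intro rec_intros; simp)

lemma run_select:
  obtains e where "\<And>r q. run e (pair r q) = Some (if q 0 = 0 then fst_part r else snd_part r)"
proof -
  have "recfun 1 (\<lambda>p xs. if p 1 = 0 then p (4 * xs ! 0) else p (4 * xs ! 0 + 2))"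
    by (intro rec_intros; simp)
  then obtain e where e: "\<And>p. run e p = Some (\<lambda>n. if p 1 = 0 then p (4 * n) else p (4 * n + 2))"
    using recfun_imp_run[of "\<lambda>p n. if p 1 = 0 then p (4 * n) else p (4 * n + 2)"] by blast
  show thesis
  proof (rule that)
    fix r q :: baire
    have "4 * n div 2 = 2 * n" "(4 * n + 2) div 2 = 2 * n + 1" for n :: nat by simp_all
    then show "run e (pair r q) = Some (if q 0 = 0 then fst_part r else snd_part r)"
      unfolding e by (auto simp: pair_def fst_part_def snd_part_def)
  qed
qed

lemma recfun_name:
  assumes "computable (\<lambda>r. Some (s r))"
  shows "recfun 1 (\<lambda>q xs. pair (s (snd_part q)) (excluded (fst_part q) (snd_part q)) (xs ! 0))"
proof -
  have "recfun 1 (\<lambda>p xs. snd_part p (xs ! 0))"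
    unfolding snd_part_def by (intro rec_intros; simp)
  then have s: "recfun 1 (\<lambda>q xs. s (snd_part q) (xs ! 0))"
    using computable_imp_recfun[OF assms] by (rule recfun_oracle)
  show ?thesis
    unfolding pair_def
    by (intro recfun_if recpred_even recfun_comp1[OF s] recfun_comp1[OF recfun_excluded] rec_intros; simp)
qed


section \<open>The two reductions\<close>

lemma closed_rep_unit:
  "closed_rep unit_rep unit_open_rep p = Some ({0..1} - (\<Union>k\<in>enumerated p. rat_interval k))"
  by (auto simp: closed_rep_def unit_open_rep_def ran_unit_rep)

lemma closed_rep_two:
  "closed_rep two_rep two_open_rep p =
     (if enumerated p \<subseteq> {0, 1} then Some ({0, 1} - enumerated p) else None)"
  by (simp add: closed_rep_def two_open_rep_def ran_two_rep)

lemma mcomp_mvf_of_iff: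
  "z \<in> mcomp (mvf_of F) g y \<longleftrightarrow> (\<exists>x\<in>g y. F x = Some z) \<and> (\<forall>x\<in>g y. \<exists>w. F x = Some w)"
proof -
  have "mdom (mvf_of F) = dom F" by (auto simp: mdom_def mvf_of_def)
  then show ?thesis by (auto simp: mcomp_def mdom_def[of g] mvf_of_def)
qed

lemma Phi_mvf_iff:
  "z \<in> Phi_mvf u d d' p y \<longleftrightarrow>
     (\<exists>q s. cyl d q = Some y \<and> Phi u p q = Some s \<and> d' s = Some z) \<and>
     (\<forall>q. cyl d q = Some y \<longrightarrow> (\<exists>s w. Phi u p q = Some s \<and> d' s = Some w))"
proof (cases "\<forall>q. cyl d q = Some y \<longrightarrow> (\<exists>s. Phi u p q = Some s)")
  case True
  then have "s \<in> mcomp (mvf_of (Phi u p)) (minverse (cyl d)) y \<longleftrightarrow>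
      (\<exists>q. cyl d q = Some y \<and> Phi u p q = Some s)" for s
    unfolding mcomp_mvf_of_iff minverse_def by blast
  then show ?thesis unfolding Phi_mvf_def mcomp_mvf_of_iff Bex_def Ball_def using True by force
next
  case False
  then have "s \<notin> mcomp (mvf_of (Phi u p)) (minverse (cyl d)) y" for s
    unfolding mcomp_mvf_of_iff minverse_def by blast
  then show ?thesis unfolding Phi_mvf_def mcomp_mvf_of_iff Bex_def Ball_def using False by blast
qed

lemma cyl_two_rep_iff: "cyl two_rep q = Some b \<longleftrightarrow> b \<in> {0, 1} \<and> q 0 = b"
  by (auto simp: cyl_def two_rep_def fst_part_def split: if_splits)

lemma Phi_mvf_select:
  assumes run: "\<And>q. run u (pair h q) = Some (if q 0 = 0 then fst_part r else snd_part r)"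
    and x: "unit_rep (fst_part r) = Some (x 0)" "unit_rep (snd_part r) = Some (x (Suc 0))"
    and b: "b \<in> {0, 1}"
  shows "Phi_mvf u two_rep unit_rep h b = {x b}"
proof -
  have P: "\<exists>s. Phi u h q = Some s \<and> unit_rep s = Some (x b)" if "q 0 = b" for q
    using that b x by (auto simp: Phi_def run)
  have "cyl two_rep q = Some b \<longleftrightarrow> q 0 = b" for q
    using b by (auto simp: cyl_two_rep_iff)
  then have "z \<in> Phi_mvf u two_rep unit_rep h b \<longleftrightarrow> z = x b" for z
    unfolding Phi_mvf_iff using P P[of "\<lambda>_. b"] by fastforce
  then show ?thesis by blast
qed

lemma implication_solution:
  assumes run: "\<And>q. run u (pair h q) = Some (if q 0 = 0 then fst_part r else snd_part r)"
    and x: "unit_rep (fst_part r) = Some (x 0)" "unit_rep (snd_part r) = Some (x (Suc 0))"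
    and A: "A \<in> ran (closed_rep unit_rep unit_open_rep)"
    and B: "B = {b \<in> {0, 1}. x b \<in> A}" "B \<noteq> {}" "B \<in> ran (closed_rep two_rep two_open_rep)"
  shows "(Phi_mvf u two_rep unit_rep h, B) \<in> rel (implication u C_two C_unit) A"
proof -
  let ?H = "Phi_mvf u two_rep unit_rep h"
  have two: "rel C_two B = B" using B(3) by (simp add: C_two_def closed_choice_def)
  have unit: "rel C_unit A = A" using A by (simp add: C_unit_def closed_choice_def)
  have H: "?H b = {x b}" if "b \<in> {0, 1}" for b
    using run x that by (rule Phi_mvf_select)
  have "z \<in> mcomp ?H (rel C_two) B \<longleftrightarrow> (\<exists>b\<in>B. z = x b)" for z
  proof -
    have "B \<subseteq> mdom ?H" using H B(1) by (auto simp: mdom_def)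
    moreover have "(\<exists>b\<in>B. z \<in> ?H b) \<longleftrightarrow> (\<exists>b\<in>B. z = x b)" using H B(1) by blast
    ultimately show ?thesis using B(2) two by (simp add: mcomp_def mdom_def)
  qed
  then have comp: "mcomp ?H (rel C_two) B = x ` B" by blast
  have "?H \<in> ran (mvf_rep u two_rep unit_rep)" by (auto simp: mvf_rep_def ran_def)
  moreover have "x ` B \<subseteq> A" "x ` B \<noteq> {}" "A \<noteq> {}" using B(1,2) by auto
  moreover have "tgt C_two = two_rep" "tgt C_unit = unit_rep"
    "src C_two = closed_rep two_rep two_open_rep"
    by (simp_all add: C_two_def C_unit_def closed_choice_def)
  ultimately show ?thesis
    using B(3) comp unit by (simp add: implication_def mdom_def)
qed

lemma ex_implication_solution:
  assumes u: "universal u" and A: "A \<in> ran (closed_rep unit_rep unit_open_rep)" "A \<noteq> {}"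
  shows "A \<in> mdom (rel (implication u C_two C_unit))"
proof -
  obtain e where e: "\<And>r q. run e (pair r q) = Some (if q 0 = 0 then fst_part r else snd_part r)"
    by (rule run_select) blast
  obtain s where s: "\<And>p q. run u (pair (s p) q) = run e (pair p q)"
    using u unfolding universal_def by blast
  obtain a where a: "a \<in> A" using A(2) by blast
  then have "a \<in> ran unit_rep" using A(1) unfolding ran_closed_rep_unit ran_unit_rep by blast
  then obtain r0 where r0: "unit_rep r0 = Some a" by (auto simp: ran_def)
  have "closed_rep two_rep two_open_rep (\<lambda>_. 0) = Some {0, 1}"
    by (simp add: closed_rep_two enumerated_def)
  then have "{0, 1} \<in> ran (closed_rep two_rep two_open_rep)" unfolding ran_def by blast
  then have "(Phi_mvf u two_rep unit_rep (s (pair r0 r0)), {0, 1}) \<in> rel (implication u C_two C_unit) A"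
    by (intro implication_solution[where r = "pair r0 r0" and x = "\<lambda>_. a"])
      (use s e r0 A a in auto)
  then show ?thesis by (auto simp: mdom_def)
qed

lemma implication_solutionD:
  assumes r: "tgt (implication u C_two C_unit) r = Some y"
    and y: "y \<in> rel (implication u C_two C_unit) A"
  obtains B where
    "closed_rep two_rep two_open_rep (snd_part r) = Some B" "B \<noteq> {}"
    "\<And>b. b \<in> B \<Longrightarrow> \<exists>s z. run u (in_oracle b r) = Some s \<and> unit_rep s = Some z \<and> z \<in> A"
proof -
  have defs: "tgt C_two = two_rep" "tgt C_unit = unit_rep"
    "src C_two = closed_rep two_rep two_open_rep"
    by (simp_all add: C_two_def C_unit_def closed_choice_def)
  let ?H = "Phi_mvf u two_rep unit_rep (fst_part r)"
  obtain B where B: "closed_rep two_rep two_open_rep (snd_part r) = Some B" "y = (?H, B)"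
    using r by (auto simp: implication_def defs prod_rep_def mvf_rep_def split: option.splits)
  have two: "rel C_two B = B" using B(1) by (auto simp: C_two_def closed_choice_def intro: ranI)
  have comp: "mcomp ?H (rel C_two) B \<noteq> {}" "mcomp ?H (rel C_two) B \<subseteq> rel C_unit A"
    using y by (auto simp: implication_def B(2) mdom_def)
  then have ne: "B \<noteq> {}" and dom: "B \<subseteq> mdom ?H"
    by (auto simp: mcomp_def two mdom_def)
  have H: "?H b \<subseteq> A" if "b \<in> B" for b
    using that comp(2) ne dom
    by (fastforce simp: mcomp_def[of ?H] two mdom_def[of "rel C_two"] C_unit_def closed_choice_def split: if_splits)
  have B01: "B \<subseteq> {0, 1}" using B(1) by (auto simp: closed_rep_two split: if_splits)
  show thesis
  proof (rule that[OF B(1) ne])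
    fix b assume b: "b \<in> B"
    then have cyl: "cyl two_rep (\<lambda>_. b) = Some b" using B01 by (auto simp: cyl_two_rep_iff)
    have "?H b \<noteq> {}" using b dom by (auto simp: mdom_def)
    then obtain w where w: "w \<in> ?H b" by blast
    obtain s z where s: "Phi u (fst_part r) (\<lambda>_. b) = Some s" "unit_rep s = Some z"
      using w cyl unfolding Phi_mvf_iff by blast
    then have "z \<in> ?H b" using w cyl unfolding Phi_mvf_iff by blast
    then show "\<exists>s z. run u (in_oracle b r) = Some s \<and> unit_rep s = Some z \<and> z \<in> A"
      using s H[OF b] by (auto simp: Phi_def in_oracle_def)
  qed
qed

lemma solve_correct:
  assumes B: "closed_rep two_rep two_open_rep (snd_part r) = Some B"
    and run: "\<And>b. b \<in> B \<Longrightarrow> \<exists>s z. run u (in_oracle b r) = Some s \<and> unit_rep s = Some z \<and> z \<in> A"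
    and b: "b \<in> {0, 1}"
  shows "\<exists>t. ready (stage u b r) (removed b r) t n"
    and "\<exists>z. unit_rep (solve u b r) = Some z \<and> (b \<in> B \<longrightarrow> z \<in> A)"
proof -
  have enum: "B = {0, 1} - enumerated (snd_part r)"
    using B by (auto simp: closed_rep_two split: if_splits)
  have "(\<forall>n. \<exists>t. ready (stage u b r) (removed b r) t n) \<and>
      (\<exists>z. unit_rep (solve u b r) = Some z \<and> (b \<in> B \<longrightarrow> z \<in> A))"
  proof (cases "b \<in> B")
    case True
    then obtain s z where s: "run u (in_oracle b r) = Some s" "unit_rep s = Some z" "z \<in> A"
      using run by blast
    have R: "\<not> removed b r t" for t
      using True unfolding enum removed_def enumerated_def by (auto intro: range_eqI dest: sym)
    note st = stage_run[OF s(1)]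
    show ?thesis
      unfolding solve_def
      using unit_rep_guarded[where f = "stage u b r" and R = "removed b r", OF stage_mono st s(2) R] s(3)
      by blast
  next
    case False
    then have "Suc b \<in> range (snd_part r)" using b by (auto simp: enum enumerated_def)
    then obtain m where "snd_part r m = Suc b" by (auto simp: image_iff)
    then have "removed b r (Suc m)" by (auto simp: removed_def)
    then have ready: "\<exists>t. ready (stage u b r) (removed b r) t n" for n
      by (auto simp: ready_def)
    then show ?thesis
      using ex_unit_rep_guarded[where f = "stage u b r", OF stage_mono ready] False
      by (simp add: solve_def)
  qed
  then show "\<exists>t. ready (stage u b r) (removed b r) t n"
    "\<exists>z. unit_rep (solve u b r) = Some z \<and> (b \<in> B \<longrightarrow> z \<in> A)" by blast+
qed

lemma computable_id: "computable Some"
proof -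
  have "recfun 1 (\<lambda>p xs. p (xs ! 0))" by (intro rec_intros; simp)
  from recfun_imp_computable[of "\<lambda>p. p", OF this] show ?thesis .
qed

lemma run_computable: "computable (run e)"
  unfolding computable_def by (rule exI[of _ e]) (simp add: map_le_def)

lemma half_le_implication:
  assumes u: "universal u"
  shows "half_C_unit \<le>\<^sub>W implication u C_two C_unit"
proof -
  obtain e where e: "\<And>p r. (\<And>n. \<exists>t. ready (stage u 0 r) (removed 0 r) t n) \<Longrightarrow>
       (\<And>n. \<exists>t. ready (stage u 1 r) (removed 1 r) t n) \<Longrightarrow>
       run e (pair p r) = Some (pair (solve u 0 r) (solve u 1 r))"
    using run_solve[of u] by blast
  have "realizes (\<lambda>p. case (G \<circ>\<^sub>m Some) p of Some r \<Rightarrow> run e (pair p r) | None \<Rightarrow> None) half_C_unit"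
    if G: "realizes G (implication u C_two C_unit)" for G
    unfolding realizes_def
  proof (intro allI impI)
    fix p A assume *: "src half_C_unit p = Some A \<and> A \<in> mdom (rel half_C_unit)"
    then have p: "closed_rep unit_rep unit_open_rep p = Some A" and A: "A \<noteq> {}"
      by (auto simp: half_C_unit_def mdom_def)
    have A': "A \<in> ran (closed_rep unit_rep unit_open_rep)" using p unfolding ran_def by blast
    have "src (implication u C_two C_unit) p = Some A"
      using p by (simp add: implication_def C_unit_def closed_choice_def)
    then obtain r y where r: "G p = Some r" "tgt (implication u C_two C_unit) r = Some y"
      "y \<in> rel (implication u C_two C_unit) A"
      using G ex_implication_solution[OF u A' A] unfolding realizes_def by blast
    from r(2,3) obtain B where B: "closed_rep two_rep two_open_rep (snd_part r) = Some B" "B \<noteq> {}"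
      and run: "\<And>b. b \<in> B \<Longrightarrow> \<exists>s z. run u (in_oracle b r) = Some s \<and> unit_rep s = Some z \<and> z \<in> A"
      by (rule implication_solutionD) blast
    note sol = solve_correct[OF B(1) run]
    obtain z0 z1 where z0: "unit_rep (solve u 0 r) = Some z0" "0 \<in> B \<longrightarrow> z0 \<in> A"
      and z1: "unit_rep (solve u 1 r) = Some z1" "1 \<in> B \<longrightarrow> z1 \<in> A"
      using sol(2)[of 0] sol(2)[of 1] by auto
    have K: "run e (pair p r) = Some (pair (solve u 0 r) (solve u 1 r))"
      by (rule e) (rule sol(1); simp)+
    have "B \<subseteq> {0, 1}" using B(1) by (auto simp: closed_rep_two split: if_splits)
    then have "z0 \<in> A \<or> z1 \<in> A" using B(2) z0(2) z1(2) by auto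
    moreover have "z0 \<in> {0..1}" "z1 \<in> {0..1}" using z0(1) z1(1) unfolding unit_rep_eq_Some_iff by auto
    ultimately have "(z0, z1) \<in> rel half_C_unit A" using A A' by (simp add: half_C_unit_def)
    moreover have "tgt half_C_unit (pair (solve u 0 r) (solve u 1 r)) = Some (z0, z1)"
      using z0(1) z1(1) by (simp add: half_C_unit_def prod_rep_def)
    ultimately show "\<exists>r y. (case (G \<circ>\<^sub>m Some) p of Some r \<Rightarrow> run e (pair p r) | None \<Rightarrow> None) = Some r \<and>
        tgt half_C_unit r = Some y \<and> y \<in> rel half_C_unit A"
      using r(1) K by simp
  qed
  then show ?thesis
    unfolding weihrauch_le_def using computable_id run_computable[of e] by blast
qed

lemma implication_le_half:
  assumes u: "universal u"
  shows "implication u C_two C_unit \<le>\<^sub>W half_C_unit"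
proof -
  obtain e where e: "\<And>r q. run e (pair r q) = Some (if q 0 = 0 then fst_part r else snd_part r)"
    by (rule run_select) blast
  obtain s where s: "computable (\<lambda>p. Some (s p))" "\<And>p q. run u (pair (s p) q) = run e (pair p q)"
    using u unfolding universal_def by blast
  define K where "K q = pair (s (snd_part q)) (excluded (fst_part q) (snd_part q))" for q
  have K: "computable (\<lambda>q. Some (K q))"
    unfolding K_def using recfun_name[OF s(1)] by (rule recfun_imp_computable)
  have "realizes (\<lambda>p. case (G \<circ>\<^sub>m Some) p of Some r \<Rightarrow> Some (K (pair p r)) | None \<Rightarrow> None)
      (implication u C_two C_unit)"
    if G: "realizes G half_C_unit" for G
    unfolding realizes_def
  proof (intro allI impI)
    fix p A
    assume *: "src (implication u C_two C_unit) p = Some A \<and> A \<in> mdom (rel (implication u C_two C_unit))"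
    then have p: "closed_rep unit_rep unit_open_rep p = Some A"
      by (simp add: implication_def C_unit_def closed_choice_def)
    have A': "A \<in> ran (closed_rep unit_rep unit_open_rep)" using p unfolding ran_def by blast
    have "A \<in> mdom (rel C_unit)" using * by (auto simp: implication_def mdom_def)
    then obtain a where "a \<in> A" by (auto simp: mdom_def C_unit_def closed_choice_def split: if_splits)
    then have "(a, a) \<in> rel half_C_unit A"
      using A' by (auto simp: half_C_unit_def ran_closed_rep_unit)
    then have "A \<in> mdom (rel half_C_unit)" unfolding mdom_def by blast
    moreover have "src half_C_unit p = Some A" using p by (simp add: half_C_unit_def)
    ultimately obtain r y where r: "G p = Some r" "tgt half_C_unit r = Some y" "y \<in> rel half_C_unit A"
      using G unfolding realizes_def by blast
    obtain x0 x1 where x01: "unit_rep (fst_part r) = Some x0" "unit_rep (snd_part r) = Some x1"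
      "y = (x0, x1)"
      using r(2) by (auto simp: half_C_unit_def prod_rep_def split: option.splits)
    define x where "x b = (if b = 0 then x0 else x1)" for b :: nat
    have x: "unit_rep (fst_part r) = Some (x 0)" "unit_rep (snd_part r) = Some (x (Suc 0))"
      using x01 by (simp_all add: x_def)
    define B where "B = {b \<in> {0, 1}. x b \<in> A}"
    have "x b \<in> {0..1}" for b using x01 by (auto simp: x_def unit_rep_eq_Some_iff)
    then have "x b \<in> A \<longleftrightarrow> x b \<notin> (\<Union>k\<in>enumerated p. rat_interval k)" for b
      using p unfolding closed_rep_unit by blast
    then have B: "closed_rep two_rep two_open_rep (excluded p r) = Some B"
      unfolding closed_rep_two enumerated_excluded[OF x] B_def by auto
    have "B \<noteq> {}" using r(3) x01(3) by (auto simp: half_C_unit_def B_def x_def)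
    then have "(Phi_mvf u two_rep unit_rep (s r), B) \<in> rel (implication u C_two C_unit) A"
      using B by (intro implication_solution[where r = r and x = x]) (auto simp: s e x A' B_def intro: ranI)
    moreover have "tgt (implication u C_two C_unit) (K (pair p r)) =
        Some (Phi_mvf u two_rep unit_rep (s r), B)"
      using B by (simp add: implication_def K_def prod_rep_def mvf_rep_def C_two_def C_unit_def closed_choice_def)
    ultimately show "\<exists>r y. (case (G \<circ>\<^sub>m Some) p of Some r \<Rightarrow> Some (K (pair p r)) | None \<Rightarrow> None) = Some r \<and>
        tgt (implication u C_two C_unit) r = Some y \<and> y \<in> rel (implication u C_two C_unit) A"
      using r(1) by simp
  qed
  then show ?thesis
    unfolding weihrauch_le_def using computable_id K by blast
qed

theorem proposition6p1:
  fixes u :: prog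
  assumes "universal u"
  shows "half_C_unit \<equiv>\<^sub>W implication u C_two C_unit"
  unfolding weihrauch_equiv_def
  using half_le_implication[OF assms] implication_le_half[OF assms] by blast

end
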